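(* Let $(R,\mathfrak{m})$ be a complete (Noetherian) local ring with coefficient field $k$, and let $\mathcal{D}=\mathcal{D}(R,k)$ be the ring of $k$-linear differential operators on $R$. Let $M$ be a left $\mathcal{D}$-module. Then the Matlis dual $D(M)=\operatorname{Hom}_R(M,E)$ has a natural structure of right $\mathcal{D}$-module. If $M$ is a right $\mathcal{D}$-module, $D(M)$ has a natural structure of left $\mathcal{D}$-module.
   Context: $k$ is a coefficient field of $R$: a subfield $k\subset R$ mapping isomorphically onto $R/\mathfrak{m}$. $\mathcal{D}(R,k)=\bigcup_j\mathcal{D}^j(R)\subset\operatorname{End}_k(R)$, where $\mathcal{D}^0(R)$ consists of multiplications by elements of $R$ and, for $j\geq 1$, $d\in\operatorname{End}_k(R)$ lies in $\mathcal{D}^j(R)$ iff $[d,r]=dr-rd\in\mathcal{D}^{j-1}(R)$ for all $r\in R$. $\mathcal{D}$-modules are regarded as $R$-modules via $R\subset\mathcal{D}$. $E$ is a fixed injective hull of $R/\mathfrak{m}\simeq k$ as an $R$-module, and $\sigma:E\to k$ is a fixed $k$-linear projection of $E$ onto its one-dimensional socle $(0:_E\mathfrak{m})$, identified with $k$. The structure on the dual is defined by Matlis dualizing the action of each differential operator: for a left $\mathcal{D}$-module $M$, the right action of $\delta\in\mathcal{D}$ on $\phi\in D(M)$ is $\phi\cdot\delta=\delta^*(\phi)$, and the case of a right $\mathcal{D}$-module is symmetric. Here $\delta^*$ is the Matlis dual of the map $\delta:M\to M$ given by the action of $\delta$, defined as follows. A $k$-linear map $\delta:M\to N$ of $R$-modules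 is $\Sigma$-continuous if for every finitely generated $R$-submodule $M_\lambda\subset M$, the $R$-submodule $\langle\delta(M_\lambda)\rangle\subset N$ generated by $\delta(M_\lambda)$ is finitely generated and $\delta|_{M_\lambda}:M_\lambda\to\langle\delta(M_\lambda)\rangle$ is continuous for the $\mathfrak{m}$-adic topologies; elements of $\mathcal{D}$ act on $\mathcal{D}$-modules by $\Sigma$-continuous maps. $D^\Sigma(M)$ is the set of $\Sigma$-continuous $k$-linear maps $M\to k$, with $R$-action $(r\cdot\lambda)(m)=\lambda(rm)$, and $\Phi_M:D(M)\to D^\Sigma(M)$, $\phi\mapsto\sigma\circ\phi$, is an $R$-linear isomorphism. The Matlis dual of a $\Sigma$-continuous map $\delta:M\to N$ is $\delta^*=\Phi_M^{-1}\circ\delta^\vee\circ\Phi_N:D(N)\to D(M)$, where $\delta^\vee(\lambda)=\lambda\circ\delta$. *)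

theory Defs
  imports "HOL-Analysis.Abstract_Topology" "HOL-Library.Function_Algebras"
begin

text \<open>
  Rings and modules are types (classes \<open>comm_ring_1\<close> and \<open>ab_group_add\<close>) with an explicit scalar
  multiplication in the sense of the locale \<^locale>\<open>module\<close>; submodules are
  \<^const>\<open>module.subspace\<close>, generated submodules are \<^const>\<open>module.span\<close>, and ideals are the
  submodules of the ring with respect to \<open>(*)\<close>. The maximal ideal is called \<open>m\<close> and the coefficient
  field, a subset of the ring, is called \<open>k\<close>. Addition on function types is pointwise.
\<close>

section \<open>Complete local rings and coefficient fields\<close>

abbreviation ring_ideal :: "'r::comm_ring_1 set \<Rightarrow> bool" where
  "ring_ideal \<equiv> module.subspace (*)"

definition fin_gen :: "('r::comm_ring_1 \<Rightarrow> 'm::ab_group_add \<Rightarrow> 'm) \<Rightarrow> 'm set \<Rightarrow> bool" where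
  "fin_gen s N \<longleftrightarrow> (\<exists>F. finite F \<and> N = module.span s F)"

definition ideal_smult ::
    "('r::comm_ring_1 \<Rightarrow> 'm::ab_group_add \<Rightarrow> 'm) \<Rightarrow> 'r set \<Rightarrow> 'm set \<Rightarrow> 'm set" where
  "ideal_smult s I N = module.span s {s a x | a x. a \<in> I \<and> x \<in> N}"

primrec ideal_pow :: "'r::comm_ring_1 set \<Rightarrow> nat \<Rightarrow> 'r set" where
  "ideal_pow I 0 = UNIV"
| "ideal_pow I (Suc n) = ideal_smult (*) I (ideal_pow I n)"

definition max_ideal :: "'r::comm_ring_1 set \<Rightarrow> bool" where
  "max_ideal I \<longleftrightarrow> ring_ideal I \<and> I \<noteq> UNIV \<and>
     (\<forall>J. ring_ideal J \<and> I \<subseteq> J \<longrightarrow> J = I \<or> J = UNIV)"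

text \<open>
  The last clause says that \<open>R \<rightarrow> lim R/m^n\<close> is bijective: a compatible family of residue classes
  modulo the powers of \<open>m\<close> is represented by a sequence \<open>x\<close>, and a preimage of the family is a \<open>y\<close>
  with \<open>y - x n \<in> m^n\<close> for all \<open>n\<close>.
\<close>

definition complete_noetherian_local_ring :: "'r::comm_ring_1 set \<Rightarrow> bool" where
  "complete_noetherian_local_ring m \<longleftrightarrow>
     (\<forall>I :: 'r set. ring_ideal I \<longrightarrow> fin_gen (*) I) \<and>
     max_ideal m \<and> (\<forall>I. max_ideal I \<longrightarrow> I = m) \<and>
     (\<forall>x. (\<forall>n. x (Suc n) - x n \<in> ideal_pow m n) \<longrightarrow>
          (\<exists>!y. \<forall>n. y - x n \<in> ideal_pow m n))"

definition residue_class :: "'r::comm_ring_1 set \<Rightarrow> 'r \<Rightarrow> 'r set" where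
  "residue_class m r = {x. x - r \<in> m}"

definition coefficient_field :: "'r::comm_ring_1 set \<Rightarrow> 'r set \<Rightarrow> bool" where
  "coefficient_field k m \<longleftrightarrow>
     0 \<in> k \<and> 1 \<in> k \<and> (\<forall>x\<in>k. \<forall>y\<in>k. x + y \<in> k \<and> x * y \<in> k) \<and> (\<forall>x\<in>k. - x \<in> k) \<and>
     (\<forall>x\<in>k. x \<noteq> 0 \<longrightarrow> (\<exists>y\<in>k. x * y = 1)) \<and>
     bij_betw (residue_class m) k (range (residue_class m))"

section \<open>Differential operators and modules over them\<close>

text \<open>For maps between \<open>R\<close>-modules; \<open>k\<close> acts through \<open>k \<subseteq> R\<close>.\<close>

definition k_linear ::
    "'r::comm_ring_1 set \<Rightarrow> ('r \<Rightarrow> 'm::ab_group_add \<Rightarrow> 'm) \<Rightarrow> ('r \<Rightarrow> 'n::ab_group_add \<Rightarrow> 'n)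
      \<Rightarrow> ('m \<Rightarrow> 'n) \<Rightarrow> bool" where
  "k_linear k sM sN f \<longleftrightarrow>
     (\<forall>x y. f (x + y) = f x + f y) \<and> (\<forall>c\<in>k. \<forall>x. f (sM c x) = sN c (f x))"

primrec diff_ops_order :: "'r::comm_ring_1 set \<Rightarrow> nat \<Rightarrow> ('r \<Rightarrow> 'r) set" where
  "diff_ops_order k 0 = range (*)"
| "diff_ops_order k (Suc j) =
     {d. k_linear k (*) (*) d \<and> (\<forall>r. (\<lambda>x. d (r * x) - r * d x) \<in> diff_ops_order k j)}"

definition diff_ops :: "'r::comm_ring_1 set \<Rightarrow> ('r \<Rightarrow> 'r) set" where
  "diff_ops k = (\<Union>j. diff_ops_order k j)"

text \<open>
  Modules over a ring \<open>D\<close> of endomorphisms of \<open>'r\<close>, with pointwise addition and composition as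
  multiplication. The underlying abelian group is a subgroup \<open>S\<close> of \<open>'x\<close>.
\<close>

locale left_D_module =
  fixes D :: "('r::comm_ring_1 \<Rightarrow> 'r) set" and S :: "'x::ab_group_add set"
    and act :: "('r \<Rightarrow> 'r) \<Rightarrow> 'x \<Rightarrow> 'x"
  assumes zero_mem: "0 \<in> S"
    and add_mem: "x \<in> S \<Longrightarrow> y \<in> S \<Longrightarrow> x + y \<in> S"
    and uminus_mem: "x \<in> S \<Longrightarrow> - x \<in> S"
    and act_mem: "d \<in> D \<Longrightarrow> x \<in> S \<Longrightarrow> act d x \<in> S"
    and act_add: "d \<in> D \<Longrightarrow> x \<in> S \<Longrightarrow> y \<in> S \<Longrightarrow> act d (x + y) = act d x + act d y"
    and add_act: "d \<in> D \<Longrightarrow> e \<in> D \<Longrightarrow> x \<in> S \<Longrightarrow> act (d + e) x = act d x + act e x"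
    and comp_act: "d \<in> D \<Longrightarrow> e \<in> D \<Longrightarrow> x \<in> S \<Longrightarrow> act (d \<circ> e) x = act d (act e x)"
    and id_act: "x \<in> S \<Longrightarrow> act id x = x"

locale right_D_module =
  fixes D :: "('r::comm_ring_1 \<Rightarrow> 'r) set" and S :: "'x::ab_group_add set"
    and act :: "'x \<Rightarrow> ('r \<Rightarrow> 'r) \<Rightarrow> 'x"
  assumes zero_mem: "0 \<in> S"
    and add_mem: "x \<in> S \<Longrightarrow> y \<in> S \<Longrightarrow> x + y \<in> S"
    and uminus_mem: "x \<in> S \<Longrightarrow> - x \<in> S"
    and act_mem: "d \<in> D \<Longrightarrow> x \<in> S \<Longrightarrow> act x d \<in> S"
    and add_act: "d \<in> D \<Longrightarrow> x \<in> S \<Longrightarrow> y \<in> S \<Longrightarrow> act (x + y) d = act x d + act y d"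
    and act_add: "d \<in> D \<Longrightarrow> e \<in> D \<Longrightarrow> x \<in> S \<Longrightarrow> act x (d + e) = act x d + act x e"
    and act_comp: "d \<in> D \<Longrightarrow> e \<in> D \<Longrightarrow> x \<in> S \<Longrightarrow> act x (d \<circ> e) = act (act x d) e"
    and act_id: "x \<in> S \<Longrightarrow> act x id = x"

section \<open>The injective hull of the residue field\<close>

definition module_on ::
    "'b set \<Rightarrow> ('b \<Rightarrow> 'b \<Rightarrow> 'b) \<Rightarrow> ('r::comm_ring_1 \<Rightarrow> 'b \<Rightarrow> 'b) \<Rightarrow> bool" where
  "module_on B add s \<longleftrightarrow>
     (\<forall>x\<in>B. \<forall>y\<in>B. add x y \<in> B \<and> add x y = add y x) \<and>
     (\<forall>x\<in>B. \<forall>y\<in>B. \<forall>z\<in>B. add (add x y) z = add x (add y z)) \<and>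
     (\<exists>z\<in>B. (\<forall>x\<in>B. add z x = x) \<and> (\<forall>x\<in>B. \<exists>y\<in>B. add x y = z)) \<and>
     (\<forall>x\<in>B. \<forall>y\<in>B. \<forall>a b. s a x \<in> B \<and> s a (add x y) = add (s a x) (s a y) \<and>
        s (a + b) x = add (s a x) (s b x) \<and> s (a * b) x = s a (s b x) \<and> s 1 x = x)"

definition hom_on ::
    "'b set \<Rightarrow> ('b \<Rightarrow> 'b \<Rightarrow> 'b) \<Rightarrow> ('r::comm_ring_1 \<Rightarrow> 'b \<Rightarrow> 'b)
      \<Rightarrow> ('r \<Rightarrow> 'e::ab_group_add \<Rightarrow> 'e) \<Rightarrow> ('b \<Rightarrow> 'e) \<Rightarrow> bool" where
  "hom_on B add s sE f \<longleftrightarrow>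
     (\<forall>x\<in>B. \<forall>y\<in>B. f (add x y) = f x + f y) \<and> (\<forall>x\<in>B. \<forall>a. f (s a x) = sE a (f x))"

text \<open>
  Homomorphisms into \<open>E\<close> extend along every inclusion \<open>A \<subseteq> B\<close> of modules. A formula of HOL cannot
  quantify over all types, so the modules \<open>B\<close> range over those with carrier in one type \<open>'u\<close>, with
  arbitrary operations. Injective modules have this property for every \<open>'u\<close>; conversely, by
  Baer's criterion, the property for \<open>'u = 'r\<close> implies it for every other \<open>'u\<close>, because \<open>B\<close> can be
  the ring itself and \<open>A\<close> any of its ideals.
\<close>

definition injective_module ::
    "'u itself \<Rightarrow> ('r::comm_ring_1 \<Rightarrow> 'e::ab_group_add \<Rightarrow> 'e) \<Rightarrow> bool" where
  "injective_module U sE \<longleftrightarrow>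
     (\<forall>(A :: 'u set) B add s f.
        module_on B add s \<and> A \<subseteq> B \<and> module_on A add s \<and> hom_on A add s sE f \<longrightarrow>
        (\<exists>g. hom_on B add s sE g \<and> (\<forall>x\<in>A. g x = f x)))"

text \<open>
  The embedding of \<open>R/m\<close> into \<open>E\<close> is given by the homomorphism \<open>\<iota>\<close> with kernel \<open>m\<close> that it induces
  on \<open>R\<close>; \<open>E\<close> is injective and an essential extension of the image.
\<close>

definition injective_hull_residue_field ::
    "'r::comm_ring_1 set \<Rightarrow> ('r \<Rightarrow> 'e::ab_group_add \<Rightarrow> 'e) \<Rightarrow> ('r \<Rightarrow> 'e) \<Rightarrow> bool" where
  "injective_hull_residue_field m sE \<iota> \<longleftrightarrow>
     module sE \<and> injective_module TYPE('r) sE \<and>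
     module_hom (*) sE \<iota> \<and> {r. \<iota> r = 0} = m \<and>
     (\<forall>N. module.subspace sE N \<and> N \<noteq> {0} \<longrightarrow> N \<inter> range \<iota> \<noteq> {0})"

definition socle :: "'r::comm_ring_1 set \<Rightarrow> ('r \<Rightarrow> 'e::ab_group_add \<Rightarrow> 'e) \<Rightarrow> 'e set" where
  "socle m sE = {e. \<forall>a\<in>m. sE a e = 0}"

text \<open>The identification of \<open>k\<close> with the socle is the restriction of \<open>\<iota>\<close> to \<open>k\<close>.\<close>

definition socle_projection ::
    "'r::comm_ring_1 set \<Rightarrow> 'r set \<Rightarrow> ('r \<Rightarrow> 'e::ab_group_add \<Rightarrow> 'e) \<Rightarrow> ('r \<Rightarrow> 'e) \<Rightarrow> ('e \<Rightarrow> 'r)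
      \<Rightarrow> bool" where
  "socle_projection k m sE \<iota> \<sigma> \<longleftrightarrow>
     range \<sigma> \<subseteq> k \<and> k_linear k sE (*) \<sigma> \<and>
     (\<forall>e. \<iota> (\<sigma> e) \<in> socle m sE) \<and> (\<forall>e\<in>socle m sE. \<iota> (\<sigma> e) = e)"

section \<open>Continuity and Matlis duals\<close>

definition adic_topology ::
    "'r::comm_ring_1 set \<Rightarrow> ('r \<Rightarrow> 'm::ab_group_add \<Rightarrow> 'm) \<Rightarrow> 'm set \<Rightarrow> 'm topology" where
  "adic_topology m s N = topology (\<lambda>U. U \<subseteq> N \<and>
     (\<forall>x\<in>U. \<exists>n. \<forall>y\<in>ideal_smult s (ideal_pow m n) N. x + y \<in> U))"

lemma module_times: "module ((*) :: 'r::comm_ring_1 \<Rightarrow> 'r \<Rightarrow> 'r)"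
  by unfold_locales (simp_all add: algebra_simps)

lemma ideal_pow_antimono:
  assumes "n \<le> p"
  shows "ideal_pow I p \<subseteq> ideal_pow I n"
proof -
  interpret R: module "(*) :: 'a \<Rightarrow> 'a \<Rightarrow> 'a" by (rule module_times)
  have sub: "R.subspace (ideal_pow I n)" for n
    by (cases n) (simp_all add: ideal_smult_def)
  have "ideal_pow I (Suc n) \<subseteq> ideal_pow I n" for n
    unfolding ideal_pow.simps(2) ideal_smult_def
    by (rule R.span_minimal) (auto intro: R.subspace_scale[OF sub] sub)
  then show ?thesis using assms by (rule lift_Suc_antimono_le)
qed

lemma openin_adic_topology:
  assumes "module s"
  shows "openin (adic_topology m s N) U \<longleftrightarrow> U \<subseteq> N \<and>
     (\<forall>x\<in>U. \<exists>n. \<forall>y\<in>ideal_smult s (ideal_pow m n) N. x + y \<in> U)" (is "_ \<longleftrightarrow> ?open U")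
proof -
  interpret M: module s by fact
  have anti: "ideal_smult s (ideal_pow m p) N \<subseteq> ideal_smult s (ideal_pow m n) N" if "n \<le> p" for n p
    unfolding ideal_smult_def using ideal_pow_antimono[OF that] by (intro M.span_mono) blast
  define P where "P U \<longleftrightarrow> ?open U" for U
  have inter: "P (U \<inter> V)" if "P U" "P V" for U V
    unfolding P_def
  proof (intro conjI ballI)
    show "U \<inter> V \<subseteq> N" using \<open>P U\<close> by (auto simp: P_def)
    fix x assume x: "x \<in> U \<inter> V"
    then obtain n p where n: "\<forall>y\<in>ideal_smult s (ideal_pow m n) N. x + y \<in> U"
      and p: "\<forall>y\<in>ideal_smult s (ideal_pow m p) N. x + y \<in> V"
      using \<open>P U\<close> \<open>P V\<close> unfolding P_def by (meson IntE)
    have "\<forall>y\<in>ideal_smult s (ideal_pow m (max n p)) N. x + y \<in> U \<inter> V"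
      using n p anti[of n "max n p"] anti[of p "max n p"] max.cobounded1 max.cobounded2 by (meson IntI subsetD)
    then show "\<exists>n. \<forall>y\<in>ideal_smult s (ideal_pow m n) N. x + y \<in> U \<inter> V" ..
  qed
  have union: "P (\<Union>K)" if K: "\<forall>U\<in>K. P U" for K
    unfolding P_def
  proof (intro conjI ballI)
    show "\<Union>K \<subseteq> N" using K unfolding P_def by (meson Union_least)
    fix x assume "x \<in> \<Union>K"
    then obtain U where U: "U \<in> K" "x \<in> U" by (rule UnionE)
    with K obtain n where "\<forall>y\<in>ideal_smult s (ideal_pow m n) N. x + y \<in> U"
      unfolding P_def by meson
    with U have "\<forall>y\<in>ideal_smult s (ideal_pow m n) N. x + y \<in> \<Union>K" by (meson UnionI)
    then show "\<exists>n. \<forall>y\<in>ideal_smult s (ideal_pow m n) N. x + y \<in> \<Union>K" ..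
  qed
  have "istopology P"
    unfolding istopology_def using inter union by simp
  then have "openin (topology P) U \<longleftrightarrow> P U" by (simp add: topology_inverse')
  then show ?thesis by (simp only: adic_topology_def P_def [abs_def])
qed

definition Sigma_continuous ::
    "'r::comm_ring_1 set \<Rightarrow> 'r set \<Rightarrow> ('r \<Rightarrow> 'm::ab_group_add \<Rightarrow> 'm)
      \<Rightarrow> ('r \<Rightarrow> 'n::ab_group_add \<Rightarrow> 'n) \<Rightarrow> ('m \<Rightarrow> 'n) \<Rightarrow> bool" where
  "Sigma_continuous k m sM sN \<delta> \<longleftrightarrow> k_linear k sM sN \<delta> \<and>
     (\<forall>L. fin_gen sM L \<longrightarrow>
        fin_gen sN (module.span sN (\<delta> ` L)) \<and>
        continuous_map (adic_topology m sM L) (adic_topology m sN (module.span sN (\<delta> ` L))) \<delta>)"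

text \<open>
  The action of \<open>R\<close> on \<open>k\<close> comes from \<open>R \<rightarrow> R/m = k\<close>. The same formula makes all of \<open>'r\<close> an
  \<open>R\<close>-module that contains \<open>k\<close> as a submodule; maps to \<open>k\<close> are maps to this module with range in \<open>k\<close>.
\<close>

definition residue_smult :: "'r::comm_ring_1 set \<Rightarrow> 'r set \<Rightarrow> 'r \<Rightarrow> 'r \<Rightarrow> 'r" where
  "residue_smult k m r x = (THE c. c \<in> k \<and> r - c \<in> m) * x"

definition Sigma_dual ::
    "'r::comm_ring_1 set \<Rightarrow> 'r set \<Rightarrow> ('r \<Rightarrow> 'm::ab_group_add \<Rightarrow> 'm) \<Rightarrow> ('m \<Rightarrow> 'r) set" where
  "Sigma_dual k m sM =
     {f. range f \<subseteq> k \<and> Sigma_continuous k m sM (residue_smult k m) f}"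

definition matlis_dual ::
    "('r::comm_ring_1 \<Rightarrow> 'e::ab_group_add \<Rightarrow> 'e) \<Rightarrow> ('r \<Rightarrow> 'm::ab_group_add \<Rightarrow> 'm)
      \<Rightarrow> ('m \<Rightarrow> 'e) set" where
  "matlis_dual sE sM = {\<phi>. module_hom sM sE \<phi>}"

definition Phi :: "('e \<Rightarrow> 'r) \<Rightarrow> ('m \<Rightarrow> 'e) \<Rightarrow> 'm \<Rightarrow> 'r" where
  "Phi \<sigma> \<phi> = \<sigma> \<circ> \<phi>"

text \<open>
  The dual of \<open>\<delta> : M \<rightarrow> N\<close>; \<open>sM\<close> is the scalar multiplication of \<open>M\<close>, and \<open>\<phi>\<close> is an element of the
  Matlis dual of \<open>N\<close>.
\<close>

definition matlis_dual_map ::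
    "('r::comm_ring_1 \<Rightarrow> 'e::ab_group_add \<Rightarrow> 'e) \<Rightarrow> ('e \<Rightarrow> 'r) \<Rightarrow> ('r \<Rightarrow> 'm::ab_group_add \<Rightarrow> 'm)
      \<Rightarrow> ('m \<Rightarrow> 'n::ab_group_add) \<Rightarrow> ('n \<Rightarrow> 'e) \<Rightarrow> 'm \<Rightarrow> 'e" where
  "matlis_dual_map sE \<sigma> sM \<delta> \<phi> =
     inv_into (matlis_dual sE sM) (Phi \<sigma>) (Phi \<sigma> \<phi> \<circ> \<delta>)"

end

theory Submission
  imports Defs
begin

text \<open>
  An operator of order at most \<open>j\<close> on \<open>R\<close> is determined by its values on finitely many elements, since
  \<open>R = k + m\<close> and \<open>R\<close> is \<open>m\<close>-adically separated. So such operators embed \<open>R\<close>-linearly into a finite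
  power of \<open>R\<close>, and by Noetherianity the commutators \<open>[d, r]\<close> are combinations of finitely many of
  them. On a \<open>D\<close>-module this makes the submodule generated by \<open>d L\<close> finitely generated for finitely
  generated \<open>L\<close>, and \<open>d (m\<^sup>n\<^sup>+\<^sup>j L) \<subseteq> m\<^sup>n \<langle>d L\<rangle>\<close> gives continuity. A \<open>k\<close>-linear functional on \<open>R\<close> that
  vanishes on some \<open>m\<^sup>n\<close> has the form \<open>r \<mapsto> \<sigma> (r e)\<close> for a unique \<open>e \<in> E\<close>, which makes \<open>\<phi> \<mapsto> \<sigma> \<circ> \<phi>\<close>
  bijective. The module axioms for the dual can then be checked after applying this bijection, where
  duals of maps are precompositions.
\<close>

section \<open>Module structures on the ring and on ring-valued functions\<close>

interpretation ring: module "(*) :: 'r::comm_ring_1 \<Rightarrow> 'r \<Rightarrow> 'r"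
  by (rule module_times)

text \<open>With the library's orientation, rewriting by this rule together with associativity loops.\<close>

declare ring.scale_scale [simp del]

text \<open>On operators this is left composition with multiplication by \<open>c\<close>. Operators
  of bounded order thereby form a module to which spans and Noetherianity apply.\<close>

definition fun_scale :: "'r::comm_ring_1 \<Rightarrow> ('i \<Rightarrow> 'r) \<Rightarrow> 'i \<Rightarrow> 'r" where
  "fun_scale c f = (\<lambda>x. c * f x)"

interpretation funs: module "fun_scale :: 'r::comm_ring_1 \<Rightarrow> ('i \<Rightarrow> 'r) \<Rightarrow> 'i \<Rightarrow> 'r"
  by unfold_locales (simp_all add: fun_scale_def fun_eq_iff algebra_simps)

section \<open>Ideals and finite generation\<close>

lemma subspace_ideal_pow: "ring_ideal (ideal_pow I n)"
  by (cases n) (simp_all add: ideal_smult_def)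

text \<open>Each element of a span involves only finitely many generators. Generators found inside a
  span can thus be traded for members of the spanning set.\<close>

lemma (in module) finite_subset_spanE:
  assumes "finite F" "F \<subseteq> span S"
  obtains F' where "finite F'" "F' \<subseteq> S" "F \<subseteq> span F'"
proof -
  have ex: "\<exists>F'. finite F' \<and> F' \<subseteq> S \<and> x \<in> span F'" if "x \<in> span S" for x
    using that unfolding span_explicit by fast
  then obtain g where g: "\<And>x. x \<in> F \<Longrightarrow> finite (g x) \<and> g x \<subseteq> S \<and> x \<in> span (g x)"
    using assms(2) by (metis subsetD)
  have "F \<subseteq> span (\<Union>x\<in>F. g x)"
  proof
    fix x assume x: "x \<in> F"
    then have "span (g x) \<subseteq> span (\<Union>x\<in>F. g x)" by (intro span_mono) auto
    with g[OF x] show "x \<in> span (\<Union>x\<in>F. g x)" by auto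
  qed
  with g assms(1) show thesis by (intro that[of "\<Union>x\<in>F. g x"]) auto
qed

definition noetherian_ring :: "'r::comm_ring_1 itself \<Rightarrow> bool" where
  "noetherian_ring _ \<longleftrightarrow> (\<forall>I :: 'r set. ring_ideal I \<longrightarrow> fin_gen (*) I)"

text \<open>The ascending chain condition, in a form that supports induction from larger to smaller
  ideals. The union of a chain is finitely generated, and a single stage already contains the
  generators.\<close>

lemma wf_ideals:
  assumes "noetherian_ring TYPE('r::comm_ring_1)"
  shows "wf {(I :: 'r set, J). ring_ideal I \<and> ring_ideal J \<and> J \<subset> I}"
  unfolding wf_iff_no_infinite_down_chain
proof
  assume "\<exists>f. \<forall>i. (f (Suc i), f i) \<in> {(I :: 'r set, J). ring_ideal I \<and> ring_ideal J \<and> J \<subset> I}"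
  then obtain f :: "nat \<Rightarrow> 'r set"
    where "\<And>i. (f (Suc i), f i) \<in> {(I, J). ring_ideal I \<and> ring_ideal J \<and> J \<subset> I}"
    by blast
  then have f: "\<And>i. ring_ideal (f i)" "\<And>i. f i \<subset> f (Suc i)" by auto
  have mono: "f i \<subseteq> f j" if "i \<le> j" for i j
    by (rule lift_Suc_mono_le[of f]) (use f that in auto)
  have "ring_ideal (\<Union>i. f i)"
  proof (rule ring.subspaceI)
    show "0 \<in> (\<Union>i. f i)" using ring.subspace_0[OF f(1)] by auto
    show "c * x \<in> (\<Union>i. f i)" if "x \<in> (\<Union>i. f i)" for c x
      using that ring.subspace_scale[OF f(1)] by blast
    fix x y assume "x \<in> (\<Union>i. f i)" "y \<in> (\<Union>i. f i)"
    then obtain i j where "x \<in> f i" "y \<in> f j" by auto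
    then have "x \<in> f (max i j)" "y \<in> f (max i j)"
      using mono[of i "max i j"] mono[of j "max i j"] by auto
    then show "x + y \<in> (\<Union>i. f i)" using ring.subspace_add[OF f(1)] by blast
  qed
  then obtain F where F: "finite F" "(\<Union>i. f i) = ring.span F"
    using assms unfolding noetherian_ring_def fin_gen_def by auto
  then have "\<forall>x\<in>F. \<exists>i. x \<in> f i" using ring.span_superset by blast
  then obtain h where h: "\<And>x. x \<in> F \<Longrightarrow> x \<in> f (h x)" by metis
  obtain n where "\<And>x. x \<in> F \<Longrightarrow> h x \<le> n"
    using F(1) by (metis finite_imageI finite_nat_set_iff_bounded_le imageI)
  then have "F \<subseteq> f n" using h mono by blast
  then have "ring.span F \<subseteq> f n" by (rule ring.span_minimal) (rule f)
  then show False using F f(2)[of n] by auto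
qed

text \<open>Finite generation of submodules of the finite power \<open>R^A\<close>, with functions
  compared only on \<open>A\<close>. A new point \<open>a\<close> splits \<open>V\<close> into the
  kernel of evaluation at \<open>a\<close>, treated by induction, and the ideal of values at
  \<open>a\<close>.\<close>

lemma noetherian_restrict:
  fixes V :: "('i \<Rightarrow> 'r::comm_ring_1) set"
  assumes noeth: "noetherian_ring TYPE('r)" and "finite A" and "funs.subspace V"
  shows "\<exists>F\<subseteq>V. finite F \<and> (\<forall>v\<in>V. \<exists>u\<in>funs.span F. \<forall>a\<in>A. v a = u a)"
  using assms(2,3)
proof (induction A arbitrary: V)
  case empty
  then show ?case by (intro exI[of _ "{}"]) (use funs.span_zero in blast)
next
  case (insert a A)
  interpret ev: module_hom "fun_scale :: 'r \<Rightarrow> ('i \<Rightarrow> 'r) \<Rightarrow> _" "(*)" "\<lambda>v. v a"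
    by unfold_locales (simp_all add: fun_scale_def)
  note V = insert.prems
  have "funs.subspace {v \<in> V. v a = 0}"
    by (rule funs.subspaceI)
      (auto simp: ev.scale intro: funs.subspace_0[OF V] funs.subspace_add[OF V] funs.subspace_scale[OF V])
  then obtain F1 where F1: "F1 \<subseteq> {v \<in> V. v a = 0}" "finite F1"
    "\<And>v. v \<in> V \<Longrightarrow> v a = 0 \<Longrightarrow> \<exists>u\<in>funs.span F1. \<forall>b\<in>A. v b = u b"
    using insert.IH by (smt (verit, best) mem_Collect_eq)
  \<comment> \<open>Corrections from the span of \<open>F1\<close> leave the value at the new point
    alone.\<close>
  have zero: "u a = 0" if "u \<in> funs.span F1" for u
    using that F1(1) by (induction rule: funs.span_induct_alt) (auto simp: ev.scale)
  have "ring_ideal ((\<lambda>v. v a) ` V)" by (rule ev.subspace_image[OF V])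
  then obtain G where G: "finite G" "(\<lambda>v. v a) ` V = ring.span G"
    using noeth unfolding noetherian_ring_def fin_gen_def by metis
  then have "G \<subseteq> (\<lambda>v. v a) ` V" using ring.span_superset by auto
  then obtain F2 where F2: "F2 \<subseteq> V" "finite F2" "G = (\<lambda>v. v a) ` F2"
    using finite_subset_image[OF G(1)] by metis
  have "\<exists>u\<in>funs.span (F1 \<union> F2). \<forall>b\<in>insert a A. v b = u b" if v: "v \<in> V" for v
  proof -
    \<comment> \<open>Choose \<open>u2\<close> with the correct value at \<open>a\<close>; then
      \<open>v - u2\<close> falls into the kernel of the evaluation.\<close>
    have "v a \<in> (\<lambda>v. v a) ` funs.span F2"
      using v G(2) F2(3) ev.span_image by blast
    then obtain u2 where u2: "u2 \<in> funs.span F2" "v a = u2 a" by auto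
    have "u2 \<in> V" using funs.span_minimal[OF F2(1) V] u2(1) by auto
    then have "v - u2 \<in> V" using funs.subspace_diff[OF V] v by auto
    then obtain u1 where u1: "u1 \<in> funs.span F1" "\<forall>b\<in>A. (v - u2) b = u1 b"
      using F1(3)[of "v - u2"] u2(2) by auto
    have "u1 + u2 \<in> funs.span (F1 \<union> F2)"
      using u1(1) u2(1) funs.span_mono[of F1 "F1 \<union> F2"] funs.span_mono[of F2 "F1 \<union> F2"]
      by (intro funs.span_add) auto
    moreover have "\<forall>b\<in>insert a A. v b = (u1 + u2) b"
      using u1 u2 zero by (auto simp: algebra_simps)
    ultimately show ?thesis by blast
  qed
  with F1(1,2) F2(1,2) show ?case by (intro exI[of _ "F1 \<union> F2"]) auto
qed

section \<open>Differential operators\<close>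

abbreviation commutator :: "('r::comm_ring_1 \<Rightarrow> 'r) \<Rightarrow> 'r \<Rightarrow> 'r \<Rightarrow> 'r" where
  "commutator d r \<equiv> (\<lambda>x. d (r * x) - r * d x)"

lemma k_linear_diff_ops_order: "d \<in> diff_ops_order k j \<Longrightarrow> k_linear k (*) (*) d"
  by (cases j) (auto simp: k_linear_def algebra_simps)

text \<open>For fixed \<open>r\<close> the commutator is additive in the operator and, as the ring
  is commutative, compatible with a coefficient on the left. The order bound then survives by
  induction.\<close>

lemma subspace_diff_ops_order: "funs.subspace (diff_ops_order k j)"
proof (induction j)
  case 0
  show ?case
  proof (rule funs.subspaceI)
    show "0 \<in> diff_ops_order k 0" by (auto simp: fun_eq_iff intro!: range_eqI[of _ _ 0])
    show "f + g \<in> diff_ops_order k 0" if "f \<in> diff_ops_order k 0" "g \<in> diff_ops_order k 0"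
      for f g :: "'a \<Rightarrow> 'a"
    proof -
      from that obtain a b where "f = (*) a" "g = (*) b" by auto
      then have "f + g = (*) (a + b)" by (simp add: fun_eq_iff algebra_simps)
      then show ?thesis by simp
    qed
    show "fun_scale c f \<in> diff_ops_order k 0" if f: "f \<in> diff_ops_order k 0"
      for c :: 'a and f :: "'a \<Rightarrow> 'a"
    proof -
      from f obtain a where a: "f = (*) a" by auto
      have "fun_scale c f = (*) (c * a)" unfolding a by (simp add: fun_scale_def fun_eq_iff mult.assoc)
      then show ?thesis by simp
    qed
  qed
next
  case (Suc j)
  note sub = funs.subspace_0[OF Suc] funs.subspace_add[OF Suc] funs.subspace_scale[OF Suc]
  show ?case
  proof (rule funs.subspaceI)
    show "0 \<in> diff_ops_order k (Suc j)" using sub(1) by (simp add: k_linear_def zero_fun_def)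
    show "f + g \<in> diff_ops_order k (Suc j)"
      if "f \<in> diff_ops_order k (Suc j)" "g \<in> diff_ops_order k (Suc j)" for f g :: "'a \<Rightarrow> 'a"
    proof -
      have "commutator (f + g) r = commutator f r + commutator g r" for r
        by (simp add: fun_eq_iff algebra_simps)
      moreover have "commutator f r + commutator g r \<in> diff_ops_order k j" for r
        using that by (intro sub(2)) auto
      ultimately have "commutator (f + g) r \<in> diff_ops_order k j" for r by simp
      moreover have "k_linear k (*) (*) (f + g)"
        using that by (simp add: k_linear_def algebra_simps)
      ultimately show ?thesis by simp
    qed
    show "fun_scale c f \<in> diff_ops_order k (Suc j)" if f: "f \<in> diff_ops_order k (Suc j)"
      for c :: 'a and f :: "'a \<Rightarrow> 'a"
    proof -
      have "commutator (fun_scale c f) r = fun_scale c (commutator f r)" for r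
        by (simp add: fun_scale_def fun_eq_iff algebra_simps)
      moreover have "fun_scale c (commutator f r) \<in> diff_ops_order k j" for r
        using f by (intro sub(3)) auto
      ultimately have "commutator (fun_scale c f) r \<in> diff_ops_order k j" for r by metis
      moreover have "k_linear k (*) (*) (fun_scale c f)"
        using f by (simp add: fun_scale_def k_linear_def algebra_simps)
      ultimately show ?thesis by simp
    qed
  qed
qed

lemma diff_ops_order_subset: "diff_ops_order k j \<subseteq> diff_ops k"
  by (auto simp: diff_ops_def)

lemma mult_mem_diff_ops: "(*) r \<in> diff_ops k"
  using diff_ops_order_subset[of k 0] by auto

lemma ideal_pow_mult: "a \<in> I \<Longrightarrow> x \<in> ideal_pow I n \<Longrightarrow> a * x \<in> ideal_pow I (Suc n)"
  by (auto simp: ideal_smult_def intro: ring.span_base)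

lemma commutator_mem: "d \<in> diff_ops_order k (Suc j) \<Longrightarrow> commutator d r \<in> diff_ops_order k j"
  by simp

section \<open>Operators on a complete local ring\<close>

locale complete_local_ring =
  fixes m k :: "'r::comm_ring_1 set"
  assumes complete_local: "complete_noetherian_local_ring m"
    and coeff: "coefficient_field k m"
begin

lemma noetherian: "noetherian_ring TYPE('r)"
  using complete_local by (simp add: complete_noetherian_local_ring_def noetherian_ring_def)

lemma ideal_m: "ring_ideal m"
  using complete_local by (auto simp: complete_noetherian_local_ring_def max_ideal_def)

text \<open>The uniqueness half of completeness: both \<open>x\<close> and \<open>0\<close> are
  limits of the zero sequence.\<close>

lemma Inter_ideal_pow:
  assumes "\<And>n. x \<in> ideal_pow m n"
  shows "x = 0"
proof -
  have "\<exists>!y. \<forall>n. y - (\<lambda>_. 0) n \<in> ideal_pow m n"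
  proof -
    have "\<forall>n. (\<lambda>_. 0) (Suc n) - (\<lambda>_. 0) n \<in> ideal_pow m n"
      using ring.subspace_0[OF subspace_ideal_pow[of m]] by simp
    with complete_local show ?thesis
      unfolding complete_noetherian_local_ring_def by (elim conjE allE[of _ "\<lambda>_. 0"]) (erule mp)
  qed
  moreover have "0 \<in> ideal_pow m n" for n by (rule ring.subspace_0[OF subspace_ideal_pow])
  ultimately show ?thesis using assms by (metis diff_zero)
qed

text \<open>Surjectivity of \<open>k\<close> onto the residue field, that is,
  \<open>R = k + m\<close>.\<close>

lemma coeffE:
  obtains c where "c \<in> k" "r - c \<in> m"
proof -
  have "residue_class m r \<in> residue_class m ` k"
    using coeff by (simp add: coefficient_field_def bij_betw_def)
  then obtain c where c: "c \<in> k" "residue_class m r = residue_class m c" by auto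
  have "r \<in> residue_class m r" using ring.subspace_0[OF ideal_m] by (simp add: residue_class_def)
  with c have "r - c \<in> m" by (simp add: residue_class_def)
  with c(1) show thesis by (rule that)
qed

text \<open>Injectivity of \<open>k\<close> into the residue field: the sum \<open>k + m\<close> is
  direct.\<close>

lemma coeff_unique:
  assumes "c \<in> k" "c' \<in> k" "r - c \<in> m" "r - c' \<in> m"
  shows "c = c'"
proof -
  have "c - c' \<in> m" using ring.subspace_diff[OF ideal_m assms(4,3)] by simp
  then have "residue_class m c = residue_class m c'"
    using ring.subspace_add[OF ideal_m, of _ "c - c'"] ring.subspace_diff[OF ideal_m, of _ "c - c'"]
    by (force simp: residue_class_def)
  then show ?thesis
    using coeff assms(1,2) by (auto simp: coefficient_field_def bij_betw_def dest: inj_onD)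
qed

lemma coeff_0: "0 \<in> k" and coeff_1: "1 \<in> k"
  and coeff_add: "x \<in> k \<Longrightarrow> y \<in> k \<Longrightarrow> x + y \<in> k"
  and coeff_mult: "x \<in> k \<Longrightarrow> y \<in> k \<Longrightarrow> x * y \<in> k"
  and coeff_uminus: "x \<in> k \<Longrightarrow> - x \<in> k"
  and coeff_inverse: "x \<in> k \<Longrightarrow> x \<noteq> 0 \<Longrightarrow> \<exists>y\<in>k. x * y = 1"
  using coeff by (simp_all add: coefficient_field_def)

text \<open>
  The operators \<open>[d, g]\<close> with \<open>g\<close> a generator of \<open>m\<close> have lower order. If they vanish, then \<open>d\<close>
  commutes with these generators, and \<open>R = k + m\<close> gives \<open>d R \<subseteq> m\<^sup>n\<close> for all \<open>n\<close> once \<open>d 1 = 0\<close>.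
\<close>

lemma diff_ops_order_determined:
  "\<exists>A. finite A \<and> (\<forall>d\<in>diff_ops_order k j. (\<forall>a\<in>A. d a = 0) \<longrightarrow> d = 0)"
proof (induction j)
  case 0
  have "d = 0" if "d \<in> diff_ops_order k 0" "d 1 = 0" for d
    using that by (auto simp: fun_eq_iff)
  then show ?case by (intro exI[of _ "{1}"]) auto
next
  case (Suc j)
  then obtain A where A: "finite A"
    "\<And>d. d \<in> diff_ops_order k j \<Longrightarrow> (\<And>a. a \<in> A \<Longrightarrow> d a = 0) \<Longrightarrow> d = 0" by metis
  obtain G where G: "finite G" "m = ring.span G"
    using noetherian ideal_m unfolding noetherian_ring_def fin_gen_def by metis
  \<comment> \<open>Vanishing at \<open>a\<close> and at \<open>g * a\<close> makes
    \<open>commutator d g\<close> vanish at \<open>a\<close>; the point \<open>1\<close> controls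
    \<open>d\<close> on \<open>k\<close>.\<close>
  let ?A = "insert 1 (A \<union> (\<lambda>(g, a). g * a) ` (G \<times> A))"
  have "d = 0" if d: "d \<in> diff_ops_order k (Suc j)" and zero: "\<And>a. a \<in> ?A \<Longrightarrow> d a = 0" for d
  proof
    fix x
    have comm: "d (g * y) = g * d y" if g: "g \<in> G" for g y
    proof -
      have "commutator d g a = 0" if "a \<in> A" for a
        using zero[of "g * a"] zero[of a] that g by (auto intro: rev_image_eqI)
      then have "commutator d g = 0"
        using A(2)[OF commutator_mem[OF d]] by blast
      then show ?thesis by (auto dest: fun_cong[of _ _ y])
    qed
    have lin: "d (u + v) = d u + d v" "c \<in> k \<Longrightarrow> d (c * u) = c * d u" for u v c
      using k_linear_diff_ops_order[OF d] by (simp_all add: k_linear_def)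
    have d0: "d 0 = 0" using lin(1)[of 0 0] by simp
    have "d x \<in> ideal_pow m n" for n
    proof (induction n arbitrary: x)
      case 0
      then show ?case by simp
    next
      case (Suc n)
      \<comment> \<open>Generators of \<open>m\<close> pass through \<open>d\<close>, so one more
        factor from \<open>m\<close> appears in front of values covered by induction.\<close>
      have *: "d y \<in> ideal_pow m (Suc n)" if "y \<in> m" for y
        using that unfolding G(2)
      proof (induction rule: ring.span_induct_alt)
        case base
        then show ?case using d0 ring.subspace_0[OF subspace_ideal_pow] by metis
      next
        case (step c g y)
        have "d (c * g + y) = g * d c + d y" using lin(1) comm[OF step(1), of c] by (simp add: mult.commute)
        moreover have "g * d c \<in> ideal_pow m (Suc n)"
          using step(1) G(2) Suc ring.span_base by (intro ideal_pow_mult) auto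
        ultimately show ?case
          using step(2) G(2) ring.subspace_add[OF subspace_ideal_pow] by metis
      qed
      obtain c where c: "c \<in> k" "x - c \<in> m" by (rule coeffE)
      have "d x = d (x - c) + c * d 1" using lin(1)[of "x - c" c] lin(2)[OF c(1), of 1] by simp
      also have "\<dots> = d (x - c)" using zero[of 1] by simp
      finally show ?case using *[OF c(2)] by simp
    qed
    then show "d x = 0 x" using Inter_ideal_pow by simp
  qed
  with A(1) G(1) show ?case by (intro exI[of _ ?A]) blast
qed

text \<open>Commutators have lower order, so evaluation embeds them into a finite power of
  \<open>R\<close>. Noetherianity gives generators of their span, and these can be chosen among the
  commutators themselves.\<close>

lemma commutators_fin_gen:
  assumes d: "d \<in> diff_ops_order k j"
  shows "\<exists>F. finite F \<and> (\<forall>r. commutator d r \<in> funs.span (commutator d ` F))"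
proof (cases j)
  case 0
  with d have "commutator d r = 0" for r by (auto simp: fun_eq_iff)
  then show ?thesis by (intro exI[of _ "{}"]) (simp add: funs.span_zero)
next
  case (Suc i)
  obtain A where A: "finite A"
    "\<And>d. d \<in> diff_ops_order k i \<Longrightarrow> (\<And>a. a \<in> A \<Longrightarrow> d a = 0) \<Longrightarrow> d = 0"
    using diff_ops_order_determined by metis
  have mem: "commutator d r \<in> diff_ops_order k i" for r
    using d Suc commutator_mem by blast
  let ?S = "range (commutator d)"
  obtain F' where F': "F' \<subseteq> funs.span ?S" "finite F'"
    "\<And>v. v \<in> funs.span ?S \<Longrightarrow> \<exists>u\<in>funs.span F'. \<forall>a\<in>A. v a = u a"
    using noetherian_restrict[OF noetherian A(1) funs.subspace_span[of ?S]]
    by (elim exE conjE) (rule that, assumption+, erule bspec)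
  obtain F'' where F'': "finite F''" "F'' \<subseteq> ?S" "F' \<subseteq> funs.span F''"
    using funs.finite_subset_spanE[OF F'(2,1)] .
  obtain F where F: "finite F" "F'' = commutator d ` F"
    using finite_subset_image[OF F''(1,2)] by blast
  have span: "funs.span F' \<subseteq> funs.span (commutator d ` F)"
    using F''(3) F(2) funs.span_minimal[OF _ funs.subspace_span] by metis
  have span_mem: "funs.span (commutator d ` F) \<subseteq> diff_ops_order k i"
    using mem by (intro funs.span_minimal subspace_diff_ops_order) auto
  have "commutator d r \<in> funs.span (commutator d ` F)" for r
  proof -
    obtain u where u: "u \<in> funs.span F'" "\<forall>a\<in>A. commutator d r a = u a"
      using F'(3)[OF funs.span_base[OF rangeI]] by blast
    \<comment> \<open>Both operators have order at most \<open>i\<close> and agree on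
      \<open>A\<close>, which determines such operators.\<close>
    have "commutator d r - u \<in> diff_ops_order k i"
      using mem span_mem span u(1) by (intro funs.subspace_diff[OF subspace_diff_ops_order]) auto
    moreover have "(commutator d r - u) a = 0" if "a \<in> A" for a
      using u(2) that by simp
    ultimately have "commutator d r - u = 0" by (rule A(2))
    then have "commutator d r = u" by simp
    then show ?thesis using u(1) span by auto
  qed
  with F(1) show ?thesis by blast
qed

end

section \<open>Continuity of differential operators on modules\<close>

text \<open>The commutator condition for differential operators, transferred to endomaps of a
  module. Additivity and \<open>k\<close>-linearity are stated separately where they enter.\<close>

primrec module_diff_op ::
    "('r::comm_ring_1 \<Rightarrow> 'm::ab_group_add \<Rightarrow> 'm) \<Rightarrow> nat \<Rightarrow> ('m \<Rightarrow> 'm) \<Rightarrow> bool" where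
  "module_diff_op s 0 \<delta> \<longleftrightarrow> (\<forall>r x. \<delta> (s r x) = s r (\<delta> x))"
| "module_diff_op s (Suc j) \<delta> \<longleftrightarrow> (\<forall>r. module_diff_op s j (\<lambda>x. \<delta> (s r x) - s r (\<delta> x)))"

section \<open>Adic estimates on an arbitrary module\<close>

context module
begin

text \<open>Through a right action, a commutator of operators acts as the negative of the commutator
  of the actions; this restores the sign.\<close>

lemma module_diff_op_uminus: "module_diff_op scale j \<delta> \<Longrightarrow> module_diff_op scale j (\<lambda>x. - \<delta> x)"
proof (induction j arbitrary: \<delta>)
  case 0
  then show ?case by simp
next
  case (Suc j)
  have "module_diff_op scale j (\<lambda>x. - (\<delta> (r *s x) - r *s \<delta> x))" for r
    by (rule Suc.IH) (use Suc.prems in simp)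
  moreover have "(\<lambda>x. - (\<delta> (r *s x) - r *s \<delta> x)) = (\<lambda>x. - \<delta> (r *s x) - r *s (- \<delta> x))" for r
    by simp
  ultimately show ?case by simp
qed

lemma subspace_ideal_smult: "subspace (ideal_smult scale I N)"
  by (simp add: ideal_smult_def)

lemma ideal_smult_subset: "subspace N \<Longrightarrow> ideal_smult scale I N \<subseteq> N"
  unfolding ideal_smult_def by (rule span_minimal) (auto intro: subspace_scale)

lemma subset_ideal_smult_UNIV: "N \<subseteq> ideal_smult scale UNIV N"
proof
  fix x assume "x \<in> N"
  then have "1 *s x \<in> ideal_smult scale UNIV N"
    unfolding ideal_smult_def by (intro span_base) blast
  then show "x \<in> ideal_smult scale UNIV N" by simp
qed

lemma ideal_smult_SucI:
  assumes "r \<in> I" "z \<in> ideal_smult scale (ideal_pow I n) N"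
  shows "r *s z \<in> ideal_smult scale (ideal_pow I (Suc n)) N"
  using assms(2) unfolding ideal_smult_def[of scale "ideal_pow I n"]
proof (induction rule: span_induct_alt)
  case base
  then show ?case using subspace_0[OF subspace_ideal_smult] by simp
next
  case (step c x y)
  then obtain a u where x: "x = a *s u" "a \<in> ideal_pow I n" "u \<in> N" by auto
  have "r *s (c *s x) = (r * (c * a)) *s u" by (simp add: x(1) mult.assoc)
  moreover have "r * (c * a) \<in> ideal_pow I (Suc n)"
    by (intro ideal_pow_mult assms(1) ring.subspace_scale[OF subspace_ideal_pow] x(2))
  ultimately have "r *s (c *s x) \<in> ideal_smult scale (ideal_pow I (Suc n)) N"
    using x(3) unfolding ideal_smult_def by (intro span_base) blast
  with step show ?case
    by (simp only: scale_right_distrib subspace_add[OF subspace_ideal_smult])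
qed

text \<open>Splitting off one factor from \<open>I\<close> exposes products \<open>r y\<close>, to
  which the commutator identity for an operator applies.\<close>

lemma ideal_smult_Suc_subset:
  "ideal_smult scale (ideal_pow I (Suc n)) L \<subseteq>
     span {r *s y | r y. r \<in> I \<and> y \<in> ideal_smult scale (ideal_pow I n) L}" (is "_ \<subseteq> span ?S")
proof -
  have "a *s x \<in> span ?S" if "a \<in> ideal_pow I (Suc n)" "x \<in> L" for a x
    using that(1) unfolding ideal_pow.simps(2) ideal_smult_def[of "(*)"]
  proof (induction rule: ring.span_induct_alt)
    case base
    then show ?case by (simp add: span_zero)
  next
    case (step c b y)
    then obtain r t where b: "b = r * t" "r \<in> I" "t \<in> ideal_pow I n" by auto
    have "(c * t) *s x \<in> ideal_smult scale (ideal_pow I n) L"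
      using ring.subspace_scale[OF subspace_ideal_pow b(3), of c] that(2)
      unfolding ideal_smult_def by (intro span_base) blast
    moreover have "(c * b) *s x = r *s ((c * t) *s x)" by (simp add: b(1) mult.left_commute)
    ultimately have "(c * b) *s x \<in> span ?S"
      using b(2) by (intro span_base) blast
    with step show ?case by (simp add: scale_left_distrib span_add)
  qed
  then show ?thesis
    unfolding ideal_smult_def[of scale "ideal_pow I (Suc n)"] by (intro span_minimal) auto
qed

text \<open>An operator of order \<open>j\<close> loses at most \<open>j\<close> powers of
  \<open>I\<close>. In \<open>\<delta> (r y) = [\<delta>, r] y + r \<delta> y\<close> the first term
  is covered by induction on the order, the second by induction on \<open>n\<close>.\<close>

lemma module_diff_op_adic:
  assumes "module_diff_op scale j \<delta>" "\<And>x y. \<delta> (x + y) = \<delta> x + \<delta> y"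
    and "subspace L" "subspace N" "\<delta> ` L \<subseteq> N"
    and "y \<in> ideal_smult scale (ideal_pow I (n + j)) L"
  shows "\<delta> y \<in> ideal_smult scale (ideal_pow I n) N"
  using assms
proof (induction j arbitrary: \<delta> n y)
  case (0 \<delta> n y)
  have \<delta>0: "\<delta> 0 = 0" using 0(2)[of 0 0] by simp
  from 0(6) show ?case unfolding ideal_smult_def[of _ _ L] add_0_right
  proof (induction rule: span_induct_alt)
    case base
    then show ?case by (simp add: \<delta>0 subspace_0[OF subspace_ideal_smult])
  next
    case (step c x y)
    then obtain a u where x: "x = a *s u" "a \<in> ideal_pow I n" "u \<in> L" by auto
    have "\<delta> x \<in> ideal_smult scale (ideal_pow I n) N"
    proof -
      have "\<delta> x = a *s \<delta> u" "\<delta> u \<in> N" using x 0(1,5) by auto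
      with x(2) show ?thesis unfolding ideal_smult_def by (intro span_base) blast
    qed
    then have "c *s \<delta> x + \<delta> y \<in> ideal_smult scale (ideal_pow I n) N"
      using step(2) by (intro subspace_add subspace_scale subspace_ideal_smult)
    then show ?case using 0(1,2) by simp
  qed
next
  case (Suc j \<delta> n y)
  note \<delta> = Suc.prems(1,2,5) and L = Suc.prems(3) and N = Suc.prems(4) and lower_order = Suc.IH
  have \<delta>0: "\<delta> 0 = 0" using \<delta>(2)[of 0 0] by simp
  from Suc.prems(6) show ?case
  proof (induction n arbitrary: y)
    case 0
    then have "\<delta> y \<in> N" using ideal_smult_subset[OF L] \<delta>(3) by blast
    then show ?case using subset_ideal_smult_UNIV by auto
  next
    case (Suc n)
    let ?T = "ideal_smult scale (ideal_pow I (Suc n)) N"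
    have *: "\<delta> (r *s y) \<in> ?T"
      if r: "r \<in> I" and y: "y \<in> ideal_smult scale (ideal_pow I (n + Suc j)) L" for r y
    proof -
      let ?c = "\<lambda>x. \<delta> (r *s x) - r *s \<delta> x"
      have "module_diff_op scale j ?c" using \<delta>(1) by simp
      moreover have "?c (x + z) = ?c x + ?c z" for x z
        by (simp add: \<delta>(2) scale_right_distrib)
      moreover have "?c ` L \<subseteq> N"
        using \<delta>(3) by (auto intro!: subspace_diff[OF N] subspace_scale[OF N] intro: subspace_scale[OF L])
      \<comment> \<open>The same exponent, read as \<open>Suc n + j\<close>: the lower order of the
        commutator leaves one more power of \<open>I\<close>.\<close>
      moreover have "y \<in> ideal_smult scale (ideal_pow I (Suc n + j)) L" using y by simp
      ultimately have "?c y \<in> ?T"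
        by (intro lower_order L N)
      moreover have "r *s \<delta> y \<in> ?T"
        using r Suc.IH[OF y] by (rule ideal_smult_SucI)
      ultimately have "?c y + r *s \<delta> y \<in> ?T" by (intro subspace_add subspace_ideal_smult)
      then show ?thesis by simp
    qed
    have "y \<in> span {r *s y | r y. r \<in> I \<and> y \<in> ideal_smult scale (ideal_pow I (n + Suc j)) L}"
      using Suc.prems ideal_smult_Suc_subset[of I "n + Suc j" L] by auto
    then show ?case
    proof (induction rule: span_induct_alt)
      case base
      then show ?case by (simp add: \<delta>0 subspace_0[OF subspace_ideal_smult])
    next
      case (step c x y)
      then obtain r u where x: "x = r *s u" "r \<in> I"
        "u \<in> ideal_smult scale (ideal_pow I (n + Suc j)) L" by auto
      have "c *s x = r *s (c *s u)" by (simp add: x(1) mult.commute)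
      then have "\<delta> (c *s x) \<in> ?T"
        using *[OF x(2) subspace_scale[OF subspace_ideal_smult x(3), of c]] by metis
      with step(2) show ?case
        by (simp only: \<delta>(2) subspace_add[OF subspace_ideal_smult])
    qed
  qed
qed

lemma topspace_adic_topology:
  assumes "subspace N"
  shows "topspace (adic_topology I scale N) = N"
proof (rule subset_antisym)
  have "openin (adic_topology I scale N) (topspace (adic_topology I scale N))" by simp
  then show "topspace (adic_topology I scale N) \<subseteq> N"
    unfolding openin_adic_topology[OF module_axioms] by simp
  have "openin (adic_topology I scale N) N"
    unfolding openin_adic_topology[OF module_axioms]
    using ideal_smult_subset[OF assms] subspace_add[OF assms] by blast
  then show "N \<subseteq> topspace (adic_topology I scale N)" by (rule openin_subset)
qed

lemma openin_adic_ideal_smult: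
  assumes "subspace N"
  shows "openin (adic_topology I scale N) (ideal_smult scale (ideal_pow I n) N)"
  unfolding openin_adic_topology[OF module_axioms]
  using ideal_smult_subset[OF assms] subspace_add[OF subspace_ideal_smult] by blast

text \<open>The finite set \<open>F\<close>, uniform in \<open>r\<close> and \<open>x\<close>, gives
  finite generation of the span of the image; the bound \<open>j\<close> on the order gives
  continuity.\<close>

lemma Sigma_continuous_module_diff_op:
  assumes \<delta>: "k_linear k scale scale \<delta>" "module_diff_op scale j \<delta>"
    and F: "finite F" "\<And>r x. \<delta> (r *s x) \<in> span ((\<lambda>f. \<delta> (f *s x)) ` F)"
  shows "Sigma_continuous k m scale scale \<delta>"
proof -
  have add: "\<delta> (x + y) = \<delta> x + \<delta> y" for x y using \<delta>(1) by (simp add: k_linear_def)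
  then have \<delta>0: "\<delta> 0 = 0" by (metis add_cancel_right_left)
  have "fin_gen scale (span (\<delta> ` L)) \<and>
      continuous_map (adic_topology m scale L) (adic_topology m scale (span (\<delta> ` L))) \<delta>"
    if L: "fin_gen scale L" for L
  proof
    obtain X where X: "finite X" "L = span X" using L by (auto simp: fin_gen_def)
    let ?Y = "(\<lambda>(f, x). \<delta> (f *s x)) ` (F \<times> X)"
    have "\<delta> y \<in> span ?Y" if "y \<in> L" for y
      using that unfolding X(2)
    proof (induction rule: span_induct_alt)
      case base
      then show ?case by (simp add: \<delta>0 span_zero)
    next
      case (step c x y)
      have "\<delta> (c *s x) \<in> span ((\<lambda>f. \<delta> (f *s x)) ` F)" by (rule F)
      also have "\<dots> \<subseteq> span ?Y" using step(1) by (intro span_mono) auto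
      finally show ?case using step(2) by (simp add: add span_add)
    qed
    then have "span (\<delta> ` L) \<subseteq> span ?Y" by (intro span_minimal) auto
    moreover have "span ?Y \<subseteq> span (\<delta> ` L)"
      unfolding X(2) by (intro span_mono) (auto intro!: imageI intro: span_scale span_base)
    ultimately show "fin_gen scale (span (\<delta> ` L))"
      using F(1) X(1) unfolding fin_gen_def by (intro exI[of _ ?Y]) auto
    have sub: "\<delta> ` L \<subseteq> span (\<delta> ` L)" by (rule span_superset)
    have L': "subspace L" using X(2) by simp
    show "continuous_map (adic_topology m scale L) (adic_topology m scale (span (\<delta> ` L))) \<delta>"
      unfolding continuous_map_def topspace_adic_topology[OF L'] topspace_adic_topology[OF subspace_span]
    proof (intro conjI allI impI)
      show "\<delta> \<in> L \<rightarrow> span (\<delta> ` L)" using sub by auto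
      fix U assume "openin (adic_topology m scale (span (\<delta> ` L))) U"
      then have U: "\<forall>x\<in>U. \<exists>n. \<forall>y\<in>ideal_smult scale (ideal_pow m n) (span (\<delta> ` L)). x + y \<in> U"
        unfolding openin_adic_topology[OF module_axioms] by simp
      show "openin (adic_topology m scale L) {x \<in> L. \<delta> x \<in> U}"
        unfolding openin_adic_topology[OF module_axioms]
      proof (intro conjI ballI)
        fix x assume x: "x \<in> {x \<in> L. \<delta> x \<in> U}"
        then obtain n where n: "\<forall>y\<in>ideal_smult scale (ideal_pow m n) (span (\<delta> ` L)). \<delta> x + y \<in> U"
          using U by blast
        \<comment> \<open>Exponent \<open>n + j\<close> at the source guarantees exponent
          \<open>n\<close> at the target.\<close>
        have "x + y \<in> {x \<in> L. \<delta> x \<in> U}"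
          if "y \<in> ideal_smult scale (ideal_pow m (n + j)) L" for y
        proof -
          have "\<delta> y \<in> ideal_smult scale (ideal_pow m n) (span (\<delta> ` L))"
            by (rule module_diff_op_adic[OF \<delta>(2) add L' subspace_span sub that])
          moreover have "y \<in> L" using ideal_smult_subset[OF L'] that by blast
          ultimately show ?thesis using x n by (simp add: add subspace_add[OF L'])
        qed
        then show "\<exists>n. \<forall>y\<in>ideal_smult scale (ideal_pow m n) L. x + y \<in> {x \<in> L. \<delta> x \<in> U}"
          by blast
      qed auto
    qed
  qed
  with \<delta>(1) show ?thesis by (simp add: Sigma_continuous_def)
qed

end

section \<open>Closure properties of the ring of operators\<close>

lemma comp_diff_ops_order: "d \<in> diff_ops_order k j \<Longrightarrow> (*) c \<circ> d \<in> diff_ops_order k j"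
  using funs.subspace_scale[OF subspace_diff_ops_order, of d k j c]
  by (simp add: fun_scale_def comp_def)

lemma comp_diff_ops: "d \<in> diff_ops k \<Longrightarrow> (*) c \<circ> d \<in> diff_ops k"
  unfolding diff_ops_def using comp_diff_ops_order by blast

text \<open>For \<open>j = 0\<close> the commutator is \<open>0\<close>, so truncated subtraction is harmless.\<close>

lemma commutator_order: "d \<in> diff_ops_order k j \<Longrightarrow> commutator d r \<in> diff_ops_order k (j - 1)"
proof (cases j)
  case 0
  assume "d \<in> diff_ops_order k j"
  with 0 have "commutator d r = 0" by (auto simp: fun_eq_iff)
  then show ?thesis using funs.subspace_0[OF subspace_diff_ops_order] by metis
qed simp

lemma commutator_diff_ops: "d \<in> diff_ops k \<Longrightarrow> commutator d r \<in> diff_ops k"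
  unfolding diff_ops_def using commutator_order by blast

text \<open>Only sums and compositions occur, which are the operations in the module axioms; both
  kinds of module read off the action of a commutator from this.\<close>

lemma commutator_plus_comp: "commutator d r + ((*) r \<circ> d) = d \<circ> (*) r"
  by (simp add: fun_eq_iff)

lemma diff_ops_comp_coeff:
  "d \<in> diff_ops k \<Longrightarrow> c \<in> k \<Longrightarrow> d \<circ> (*) c = (*) c \<circ> d"
  by (auto simp: diff_ops_def fun_eq_iff k_linear_def dest!: k_linear_diff_ops_order)

section \<open>Left modules over the differential operators\<close>

locale left_diff_ops_module = complete_local_ring m k + left_D_module "diff_ops k" UNIV act
  for m k :: "'r::comm_ring_1 set" and act :: "('r \<Rightarrow> 'r) \<Rightarrow> 'm::ab_group_add \<Rightarrow> 'm"
begin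

abbreviation smult :: "'r \<Rightarrow> 'm \<Rightarrow> 'm" where
  "smult r \<equiv> act ((*) r)"

sublocale M: module smult
proof
  fix a b :: 'r and x y :: 'm
  have "(*) (a + b) = (*) a + (*) b" "(*) (a * b) = (*) a \<circ> (*) b" "(*) (1 :: 'r) = id"
    by (auto simp: fun_eq_iff algebra_simps)
  then show "smult (a + b) x = smult a x + smult b x" "smult a (smult b x) = smult (a * b) x"
    "smult 1 x = x"
    by (simp_all add: add_act comp_act id_act mult_mem_diff_ops)
qed (simp add: act_add mult_mem_diff_ops)

lemma act_commutator:
  assumes "d \<in> diff_ops k"
  shows "act (commutator d r) x = act d (smult r x) - smult r (act d x)"
proof -
  have "act (commutator d r + ((*) r \<circ> d)) x = act (commutator d r) x + smult r (act d x)"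
    using assms by (simp add: add_act comp_act commutator_diff_ops comp_diff_ops mult_mem_diff_ops)
  moreover have "act (d \<circ> (*) r) x = act d (smult r x)"
    using assms by (simp add: comp_act mult_mem_diff_ops)
  ultimately show ?thesis using commutator_plus_comp[of d r] by simp
qed

lemma k_linear_act:
  assumes "d \<in> diff_ops k"
  shows "k_linear k smult smult (act d)"
proof -
  have "act d (smult c x) = smult c (act d x)" if "c \<in> k" for c x
    using diff_ops_comp_coeff[OF assms that] comp_act[OF assms mult_mem_diff_ops, of x c]
      comp_act[OF mult_mem_diff_ops assms, of x c] by simp
  then show ?thesis using assms by (simp add: k_linear_def act_add)
qed

lemma module_diff_op_act: "d \<in> diff_ops_order k j \<Longrightarrow> module_diff_op smult j (act d)"
proof (induction j arbitrary: d)
  case 0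
  then show ?case by (auto simp: mult.commute)
next
  case (Suc j)
  have "module_diff_op smult j (\<lambda>x. act (commutator d r) x)" for r
    by (intro Suc.IH commutator_mem Suc.prems)
  moreover have "d \<in> diff_ops k" using Suc.prems diff_ops_order_subset by blast
  ultimately show ?case by (simp add: act_commutator)
qed

text \<open>Here \<open>d (r x) = [d, r] x + r (d x)\<close>, and \<open>[d, r]\<close> is a left
  combination of finitely many commutators. On a left module it acts as the same combination of
  their values.\<close>

lemma act_smult_span:
  assumes d: "d \<in> diff_ops_order k j"
  shows "\<exists>F. finite F \<and> (\<forall>r x. act d (smult r x) \<in> M.span ((\<lambda>f. act d (smult f x)) ` F))"
proof -
  obtain F where F: "finite F" "\<And>r. commutator d r \<in> funs.span (commutator d ` F)"
    using commutators_fin_gen[OF d] by blast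
  have dD: "d \<in> diff_ops k" using d diff_ops_order_subset by blast
  \<comment> \<open>The added element \<open>1\<close> contributes \<open>d x\<close>, which also
    occurs in \<open>[d, f] x\<close>.\<close>
  have "act d (smult r x) \<in> M.span ((\<lambda>f. act d (smult f x)) ` insert 1 F)" (is "_ \<in> ?S") for r x
  proof -
    have base: "act d (smult f x) \<in> ?S" if "f \<in> insert 1 F" for f
      using that by (intro M.span_base) blast
    then have one: "act d x \<in> ?S" using M.scale_one[of x] by force
    \<comment> \<open>The order bound keeps these operators inside \<open>diff_ops k\<close>, where
      the action axioms hold.\<close>
    let ?W = "{e \<in> diff_ops_order k (j - 1). act e x \<in> ?S}"
    have "funs.subspace ?W"
    proof (rule funs.subspaceI)
      have "act 0 x = 0"
        using add_act[of 0 0 x] funs.subspace_0[OF subspace_diff_ops_order, of k 0]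
          diff_ops_order_subset[of k 0] by auto
      then show "0 \<in> ?W"
        using funs.subspace_0[OF subspace_diff_ops_order] M.span_zero by simp
      show "e + e' \<in> ?W" if "e \<in> ?W" "e' \<in> ?W" for e e'
      proof -
        have "act (e + e') x = act e x + act e' x"
          using that diff_ops_order_subset by (intro add_act) auto
        with that show ?thesis
          using funs.subspace_add[OF subspace_diff_ops_order] M.span_add by auto
      qed
      show "fun_scale c e \<in> ?W" if "e \<in> ?W" for c e
      proof -
        have "fun_scale c e = (*) c \<circ> e" by (simp add: fun_scale_def comp_def)
        moreover have "act ((*) c \<circ> e) x = smult c (act e x)"
          using that diff_ops_order_subset by (intro comp_act mult_mem_diff_ops) auto
        ultimately show ?thesis
          using that comp_diff_ops_order M.span_scale by auto
      qed
    qed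
    moreover have "commutator d ` F \<subseteq> ?W"
      using commutator_order[OF d] base one
      by (auto simp: act_commutator[OF dD] intro!: M.span_diff M.span_scale)
    ultimately have "funs.span (commutator d ` F) \<subseteq> ?W" by (rule funs.span_minimal[rotated])
    then have "act (commutator d r) x \<in> ?S" using F(2)[of r] by auto
    then have "act (commutator d r) x + smult r (act d x) \<in> ?S"
      using one by (intro M.span_add M.span_scale)
    then show ?thesis by (simp add: act_commutator[OF dD])
  qed
  with F(1) show ?thesis by (intro exI[of _ "insert 1 F"]) auto
qed

lemma Sigma_continuous_act:
  assumes "d \<in> diff_ops k"
  shows "Sigma_continuous k m smult smult (act d)"
proof -
  obtain j where d: "d \<in> diff_ops_order k j" using assms by (auto simp: diff_ops_def)
  then obtain F where "finite F" "\<And>r x. act d (smult r x) \<in> M.span ((\<lambda>f. act d (smult f x)) ` F)"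
    using act_smult_span by blast
  with k_linear_act[OF assms] module_diff_op_act[OF d] show ?thesis
    by (rule M.Sigma_continuous_module_diff_op)
qed

end

section \<open>Right modules over the differential operators\<close>

locale right_diff_ops_module = complete_local_ring m k + right_D_module "diff_ops k" UNIV act
  for m k :: "'r::comm_ring_1 set" and act :: "'m::ab_group_add \<Rightarrow> ('r \<Rightarrow> 'r) \<Rightarrow> 'm"
begin

abbreviation smult :: "'r \<Rightarrow> 'm \<Rightarrow> 'm" where
  "smult r x \<equiv> act x ((*) r)"

sublocale M: module smult
proof
  fix a b :: 'r and x y :: 'm
  \<comment> \<open>Commutativity of the ring permits the reversed factors that a right action
    produces.\<close>
  have "(*) (a + b) = (*) a + (*) b" "(*) (a * b) = (*) b \<circ> (*) a" "(*) (1 :: 'r) = id"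
    by (auto simp: fun_eq_iff algebra_simps)
  then show "smult (a + b) x = smult a x + smult b x" "smult a (smult b x) = smult (a * b) x"
    "smult 1 x = x"
    by (simp_all add: act_add act_comp act_id mult_mem_diff_ops)
qed (simp add: add_act mult_mem_diff_ops)

text \<open>Composition acts in reverse order, so the sign is opposite to that for left
  modules.\<close>

lemma act_commutator:
  assumes "d \<in> diff_ops k"
  shows "act x (commutator d r) = smult r (act x d) - act (smult r x) d"
proof -
  have "act x (commutator d r + ((*) r \<circ> d)) = act x (commutator d r) + act (smult r x) d"
    using assms by (simp add: act_add act_comp commutator_diff_ops comp_diff_ops mult_mem_diff_ops)
  moreover have "act x (d \<circ> (*) r) = smult r (act x d)"
    using assms by (simp add: act_comp mult_mem_diff_ops)
  ultimately show ?thesis using commutator_plus_comp[of d r] by simp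
qed

lemma k_linear_act:
  assumes "d \<in> diff_ops k"
  shows "k_linear k smult smult (\<lambda>x. act x d)"
proof -
  have "act (smult c x) d = smult c (act x d)" if "c \<in> k" for c x
    using diff_ops_comp_coeff[OF assms that] act_comp[OF assms mult_mem_diff_ops, of x c]
      act_comp[OF mult_mem_diff_ops assms, of x c] by simp
  then show ?thesis using assms by (simp add: k_linear_def add_act)
qed

lemma module_diff_op_act: "d \<in> diff_ops_order k j \<Longrightarrow> module_diff_op smult j (\<lambda>x. act x d)"
proof (induction j arbitrary: d)
  case 0
  then show ?case by (auto simp: mult.commute)
next
  case (Suc j)
  have d: "d \<in> diff_ops k" using Suc.prems diff_ops_order_subset by blast
  have "module_diff_op smult j (\<lambda>x. - act x (commutator d r))" for r
    by (intro M.module_diff_op_uminus Suc.IH commutator_mem Suc.prems)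
  then show ?case by (simp add: act_commutator[OF d])
qed

text \<open>On a right module a coefficient in front of an operator acts first, on \<open>x\<close>,
  and cannot simply be pulled out of the value. Induction on the order supplies, for each commutator
  \<open>[d, f]\<close>, a finite set that handles all multiples of \<open>x\<close>.\<close>

lemma act_smult_span:
  "d \<in> diff_ops_order k j \<Longrightarrow>
    \<exists>F. finite F \<and> (\<forall>r x. act (smult r x) d \<in> M.span ((\<lambda>f. act (smult f x) d) ` F))"
proof (induction j arbitrary: d)
  case 0
  then obtain s where "d = (*) s" by auto
  then have "act (smult r x) d = smult r (act (smult 1 x) d)" for r x by (simp add: mult.commute)
  moreover have "smult r (act (smult 1 x) d) \<in> M.span ((\<lambda>f. act (smult f x) d) ` {1})" for r x
    by (intro M.span_scale M.span_base) blast
  ultimately show ?case by (intro exI[of _ "{1}"]) (metis finite.emptyI finite.insertI)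
next
  case (Suc j d)
  obtain F where F: "finite F" "\<And>r. commutator d r \<in> funs.span (commutator d ` F)"
    using commutators_fin_gen[OF Suc.prems] by blast
  have dD: "d \<in> diff_ops k" using Suc.prems diff_ops_order_subset by blast
  have "\<exists>G. \<forall>f. finite (G f) \<and> (\<forall>r x. act (smult r x) (commutator d f) \<in>
      M.span ((\<lambda>g. act (smult g x) (commutator d f)) ` G f))"
    by (intro choice allI Suc.IH[OF commutator_mem[OF Suc.prems]])
  then obtain G where G: "\<And>f. finite (G f)" "\<And>f r x. act (smult r x) (commutator d f) \<in>
      M.span ((\<lambda>g. act (smult g x) (commutator d f)) ` G f)"
    by blast
  \<comment> \<open>The products \<open>f * g\<close> come from
    \<open>(g x) [d, f] = f ((g x) d) - ((f * g) x) d\<close>.\<close>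
  let ?H = "insert 1 (\<Union>f\<in>F. G f \<union> (\<lambda>g. f * g) ` G f)"
  have "act (smult r x) d \<in> M.span ((\<lambda>h. act (smult h x) d) ` ?H)" (is "_ \<in> ?S") for r x
  proof -
    have base: "act (smult h x) d \<in> ?S" if "h \<in> ?H" for h
      using that by (intro M.span_base) blast
    then have one: "act x d \<in> ?S" using M.scale_one[of x] by force
    \<comment> \<open>Quantifying over all multiples of \<open>x\<close> makes the condition stable
      under coefficients: a factor \<open>b\<close> turns \<open>c\<close> into
      \<open>b * c\<close>.\<close>
    let ?W = "{e \<in> diff_ops_order k j. \<forall>c. act (smult c x) e \<in> ?S}"
    have "funs.subspace ?W"
    proof (rule funs.subspaceI)
      have "act y 0 = 0" for y
        using act_add[of 0 0 y] funs.subspace_0[OF subspace_diff_ops_order, of k 0]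
          diff_ops_order_subset[of k 0] by auto
      then show "0 \<in> ?W"
        using funs.subspace_0[OF subspace_diff_ops_order] M.span_zero by simp
      show "e + e' \<in> ?W" if "e \<in> ?W" "e' \<in> ?W" for e e'
      proof -
        have "act y (e + e') = act y e + act y e'" for y
          using that diff_ops_order_subset by (intro act_add) auto
        with that show ?thesis
          using funs.subspace_add[OF subspace_diff_ops_order] M.span_add by auto
      qed
      show "fun_scale b e \<in> ?W" if "e \<in> ?W" for b e
      proof -
        have "fun_scale b e = (*) b \<circ> e" by (simp add: fun_scale_def comp_def)
        moreover have "act (smult c x) ((*) b \<circ> e) = act (smult (b * c) x) e" for c
          using that diff_ops_order_subset[of k j] act_comp[OF mult_mem_diff_ops, of e] by auto
        ultimately show ?thesis
          using that comp_diff_ops_order by auto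
      qed
    qed
    moreover have "commutator d ` F \<subseteq> ?W"
    proof -
      have "act (smult c x) (commutator d f) \<in> ?S" if f: "f \<in> F" for c f
      proof -
        have "act (smult g x) (commutator d f) \<in> ?S" if g: "g \<in> G f" for g
        proof -
          have "act (smult g x) (commutator d f) =
              smult f (act (smult g x) d) - act (smult (f * g) x) d"
            using act_commutator[OF dD, of "smult g x" f] by simp
          moreover have "smult f (act (smult g x) d) \<in> ?S"
            by (intro M.span_scale base) (use f g in blast)
          moreover have "act (smult (f * g) x) d \<in> ?S"
            by (intro base) (use f g in blast)
          ultimately show ?thesis by (simp only: M.span_diff)
        qed
        then have "M.span ((\<lambda>g. act (smult g x) (commutator d f)) ` G f) \<subseteq> ?S"
          by (intro M.span_minimal M.subspace_span) blast
        with G(2) show ?thesis by blast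
      qed
      then show ?thesis using commutator_mem[OF Suc.prems] by blast
    qed
    ultimately have "funs.span (commutator d ` F) \<subseteq> ?W" by (rule funs.span_minimal[rotated])
    then have "commutator d r \<in> ?W" using F(2)[of r] by blast
    then have "act (smult 1 x) (commutator d r) \<in> ?S" by blast
    then have "smult r (act x d) - act x (commutator d r) \<in> ?S"
      using one by (intro M.span_diff M.span_scale) simp_all
    then show ?thesis by (simp add: act_commutator[OF dD])
  qed
  moreover have "finite ?H" using F(1) G(1) by auto
  ultimately show ?case by blast
qed

lemma Sigma_continuous_act:
  assumes "d \<in> diff_ops k"
  shows "Sigma_continuous k m smult smult (\<lambda>x. act x d)"
proof -
  obtain j where d: "d \<in> diff_ops_order k j" using assms by (auto simp: diff_ops_def)
  then obtain F where "finite F" "\<And>r x. act (smult r x) d \<in> M.span ((\<lambda>f. act (smult f x) d) ` F)"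
    using act_smult_span by blast
  with k_linear_act[OF assms] module_diff_op_act[OF d] show ?thesis
    by (rule M.Sigma_continuous_module_diff_op)
qed

end

section \<open>The injective hull\<close>

locale residue_injective_hull = complete_local_ring m k
  for m k :: "'r::comm_ring_1 set" +
  fixes sE :: "'r \<Rightarrow> 'e::ab_group_add \<Rightarrow> 'e" and \<iota> :: "'r \<Rightarrow> 'e" and \<sigma> :: "'e \<Rightarrow> 'r"
  assumes hull: "injective_hull_residue_field m sE \<iota>"
    and projection: "socle_projection k m sE \<iota> \<sigma>"
begin

sublocale E: module sE
  using hull by (simp add: injective_hull_residue_field_def)

sublocale \<iota>: module_hom "(*)" sE \<iota>
  using hull by (simp add: injective_hull_residue_field_def)

lemma \<iota>_eq_0_iff: "\<iota> r = 0 \<longleftrightarrow> r \<in> m"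
  using hull unfolding injective_hull_residue_field_def by blast

lemma \<iota>_socle: "\<iota> r \<in> socle m sE"
  using ring.subspace_scale[OF ideal_m, of _ r]
  by (auto simp: socle_def \<iota>.scale[symmetric] \<iota>_eq_0_iff mult.commute)

lemma \<sigma>_add: "\<sigma> (x + y) = \<sigma> x + \<sigma> y"
  and \<sigma>_scale: "c \<in> k \<Longrightarrow> \<sigma> (sE c x) = c * \<sigma> x"
  and \<sigma>_mem: "\<sigma> x \<in> k"
  and \<iota>_\<sigma>: "x \<in> socle m sE \<Longrightarrow> \<iota> (\<sigma> x) = x"
  using projection by (auto simp: socle_projection_def k_linear_def)

lemma \<sigma>_0: "\<sigma> 0 = 0"
  using \<sigma>_add[of 0 0] by simp

lemma \<sigma>_diff: "\<sigma> (x - y) = \<sigma> x - \<sigma> y"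
  using \<sigma>_add[of "x - y" y] by (simp add: algebra_simps)

text \<open>\<open>\<iota>\<close> is injective on \<open>k\<close>, because elements of
  \<open>k\<close> congruent modulo \<open>m\<close> coincide. So \<open>\<sigma>\<close> inverts
  \<open>\<iota>\<close> from this side as well.\<close>

lemma \<sigma>_\<iota>:
  assumes "c \<in> k"
  shows "\<sigma> (\<iota> c) = c"
proof -
  have "\<iota> (\<sigma> (\<iota> c) - c) = 0" by (simp add: \<iota>.diff \<iota>_\<sigma>[OF \<iota>_socle])
  then have "\<sigma> (\<iota> c) - c \<in> m" by (simp add: \<iota>_eq_0_iff)
  then show ?thesis
    using coeff_unique[of "\<sigma> (\<iota> c)" c "\<sigma> (\<iota> c)"] \<sigma>_mem assms ring.subspace_0[OF ideal_m] by simp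
qed

text \<open>Essentiality of the extension, applied to the cyclic submodule generated by
  \<open>e\<close>.\<close>

lemma essential:
  assumes "e \<noteq> 0"
  obtains r s where "sE r e = \<iota> s" "\<iota> s \<noteq> 0"
proof -
  let ?N = "range (\<lambda>r. sE r e)"
  have "E.subspace ?N"
  proof (rule E.subspaceI)
    show "0 \<in> ?N" by (intro range_eqI[of _ _ 0]) simp
    show "x + y \<in> ?N" if "x \<in> ?N" "y \<in> ?N" for x y
      using that E.scale_left_distrib[symmetric] by auto
    show "sE c x \<in> ?N" if "x \<in> ?N" for c x
      using that by auto
  qed
  moreover have "e \<in> ?N" by (intro range_eqI[of _ _ 1]) simp
  ultimately have "?N \<inter> range \<iota> \<noteq> {0}"
    using hull assms unfolding injective_hull_residue_field_def by blast
  moreover have "0 \<in> ?N \<inter> range \<iota>"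
    using \<open>E.subspace ?N\<close>[THEN E.subspace_0] \<iota>.zero by (metis IntI rangeI)
  ultimately obtain x where "x \<in> ?N" "x \<in> range \<iota>" "x \<noteq> 0" by blast
  then show thesis using that by auto
qed

text \<open>If \<open>x - y\<close> were nonzero, some multiple of it would be a nonzero socle
  element, and \<open>\<sigma>\<close> is injective on the socle. Identities in \<open>E\<close> can
  therefore be tested in \<open>k\<close>.\<close>

lemma eq_if_\<sigma>_eq:
  assumes "\<And>r. \<sigma> (sE r x) = \<sigma> (sE r y)"
  shows "x = y"
proof (rule ccontr)
  assume "x \<noteq> y"
  then have "x - y \<noteq> 0" by simp
  then obtain r s where rs: "sE r (x - y) = \<iota> s" "\<iota> s \<noteq> 0" by (rule essential)
  have "\<sigma> (sE r (x - y)) = 0" using assms by (simp add: E.scale_right_diff_distrib \<sigma>_diff)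
  then have "\<sigma> (\<iota> s) = 0" by (simp add: rs(1))
  then have "\<iota> s = 0" using \<iota>_\<sigma>[OF \<iota>_socle, of s] by simp
  with rs(2) show False by contradiction
qed

text \<open>
  Noetherian induction on the annihilator of \<open>e\<close>: by essentiality some \<open>r e \<noteq> 0\<close> lies in the socle,
  so every \<open>g \<in> m\<close> makes the annihilator of \<open>g e\<close> strictly larger.
\<close>

lemma ideal_pow_annihilates: "\<exists>n. \<forall>a\<in>ideal_pow m n. sE a e = 0"
proof (induction "{r. sE r e = 0}" arbitrary: e rule: wf_induct_rule[OF wf_ideals[OF noetherian]])
  case (1 e)
  have ann: "ring_ideal {r. sE r x = 0}" for x
    by (rule ring.subspaceI) (simp_all add: E.scale_left_distrib flip: E.scale_scale)
  show ?case
  proof (cases "e = 0")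
    case True
    then show ?thesis by simp
  next
    case False
    then obtain r s where rs: "sE r e = \<iota> s" "\<iota> s \<noteq> 0" by (rule essential)
    have "\<exists>n. \<forall>a\<in>ideal_pow m n. sE a (sE g e) = 0" if g: "g \<in> m" for g
    proof (rule "1.hyps")
      have "sE r (sE g e) = sE g (sE r e)" by (simp add: mult.commute)
      also have "\<dots> = 0" using \<iota>_socle[of s] g by (simp add: rs(1) socle_def)
      finally have "r \<in> {r. sE r (sE g e) = 0}" by simp
      moreover have "r \<notin> {r. sE r e = 0}" using rs by simp
      moreover have "{r. sE r e = 0} \<subseteq> {r. sE r (sE g e) = 0}"
        by (auto simp: E.scale_left_commute[of _ g] simp del: E.scale_scale)
      ultimately show "({r. sE r (sE g e) = 0}, {r. sE r e = 0}) \<in>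
          {(I, J). ring_ideal I \<and> ring_ideal J \<and> J \<subset> I}"
        using ann by blast
    qed
    then obtain h where h: "\<And>g a. g \<in> m \<Longrightarrow> a \<in> ideal_pow m (h g) \<Longrightarrow> sE a (sE g e) = 0"
      by metis
    obtain G where G: "finite G" "m = ring.span G"
      using noetherian ideal_m unfolding noetherian_ring_def fin_gen_def by metis
    \<comment> \<open>The exponent \<open>h g\<close> depends on \<open>g\<close>; finitely many
      generators of \<open>m\<close> make it uniform.\<close>
    obtain n where n: "\<And>g. g \<in> G \<Longrightarrow> h g \<le> n"
      using G(1) by (metis finite_imageI finite_nat_set_iff_bounded_le imageI)
    have "sE (g * x) e = 0" if "g \<in> m" "x \<in> ideal_pow m n" for g x
      using that(1) unfolding G(2)
    proof (induction rule: ring.span_induct_alt)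
      case base
      then show ?case by simp
    next
      case (step c g y)
      have "x \<in> ideal_pow m (h g)" using ideal_pow_antimono[OF n[OF step(1)]] that(2) by blast
      moreover have "g \<in> m" using step(1) G(2) ring.span_base by blast
      ultimately have "sE x (sE g e) = 0" by (intro h)
      then have "sE c (sE x (sE g e)) = 0" by simp
      with step(2) show ?case by (simp add: algebra_simps)
    qed
    then have "{g * x | g x. g \<in> m \<and> x \<in> ideal_pow m n} \<subseteq> {r. sE r e = 0}" by blast
    then have "ideal_pow m (Suc n) \<subseteq> {r. sE r e = 0}"
      unfolding ideal_pow.simps(2) ideal_smult_def by (rule ring.span_minimal) (rule ann)
    then show ?thesis by blast
  qed
qed

text \<open>Injectivity for the inclusion of \<open>J\<close> into the ring; a homomorphism on the
  whole ring is determined by the image \<open>e\<close> of \<open>1\<close>.\<close>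

lemma extend_from_ideal:
  assumes "ring_ideal J" and "\<And>x y. x \<in> J \<Longrightarrow> y \<in> J \<Longrightarrow> f (x + y) = f x + f y"
    and "\<And>r x. x \<in> J \<Longrightarrow> f (r * x) = sE r (f x)"
  obtains e where "\<And>x. x \<in> J \<Longrightarrow> sE x e = f x"
proof -
  have inj: "injective_module TYPE('r) sE"
    using hull by (simp add: injective_hull_residue_field_def)
  have module_on: "module_on B (+) (*)" if B: "ring_ideal B" for B :: "'r set"
  proof -
    have "- x \<in> B" if "x \<in> B" for x using ring.subspace_neg[OF B that] .
    then have "\<exists>z\<in>B. (\<forall>x\<in>B. z + x = x) \<and> (\<forall>x\<in>B. \<exists>y\<in>B. x + y = z)"
      using ring.subspace_0[OF B] by (intro bexI[of _ 0]) (auto intro: right_minus)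
    then show ?thesis
      using ring.subspace_add[OF B] ring.subspace_scale[OF B]
      by (simp add: module_on_def algebra_simps)
  qed
  have "\<exists>g. hom_on UNIV (+) (*) sE g \<and> (\<forall>x\<in>J. g x = f x)"
    using inj[unfolded injective_module_def, rule_format, of UNIV "(+)" "(*)" J f]
      module_on[OF assms(1)] module_on[of UNIV] assms(2,3)
    by (simp add: hom_on_def)
  then obtain g where g: "\<And>r x. g (r * x) = sE r (g x)" "\<And>x. x \<in> J \<Longrightarrow> g x = f x"
    unfolding hom_on_def by blast
  have "sE x (g 1) = f x" if "x \<in> J" for x
    using g(1)[of x 1] g(2)[OF that] by simp
  then show thesis by (rule that)
qed

text \<open>
  The restriction of \<open>\<mu>\<close> to \<open>m\<^sup>n\<close> factors through \<open>m\<^sup>n / m\<^sup>n\<^sup>+\<^sup>1\<close>, so \<open>\<iota> \<circ> \<mu>\<close> is \<open>R\<close>-linear there and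
  extends to \<open>R\<close> by injectivity; subtracting the extension leaves a functional that vanishes on \<open>m\<^sup>n\<close>.
\<close>

lemma functional_representable:
  assumes "\<And>x y. \<mu> (x + y) = \<mu> x + \<mu> y" "\<And>c x. c \<in> k \<Longrightarrow> \<mu> (c * x) = c * \<mu> x"
    and "\<And>x. \<mu> x \<in> k" and "\<And>x. x \<in> ideal_pow m n \<Longrightarrow> \<mu> x = 0"
  shows "\<exists>e. \<forall>r. \<mu> r = \<sigma> (sE r e)"
  using assms
proof (induction n arbitrary: \<mu>)
  case 0
  then show ?case by (intro exI[of _ 0]) (simp add: \<sigma>_0)
next
  case (Suc n)
  have \<mu>_scale: "\<iota> (\<mu> (r * x)) = sE r (\<iota> (\<mu> x))" if x: "x \<in> ideal_pow m n" for r x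
  proof -
    obtain c where c: "c \<in> k" "r - c \<in> m" by (rule coeffE)
    \<comment> \<open>The first summand lies in the next power of \<open>m\<close>, where
      \<open>\<mu>\<close> vanishes; the second is handled by \<open>k\<close>-linearity.\<close>
    have "r * x = (r - c) * x + c * x" by (simp add: algebra_simps)
    then have "\<mu> (r * x) = \<mu> ((r - c) * x) + c * \<mu> x"
      using Suc.prems(1,2) c(1) by metis
    also have "\<mu> ((r - c) * x) = 0" by (intro Suc.prems(4) ideal_pow_mult c(2) x)
    finally have "\<iota> (\<mu> (r * x)) = sE c (\<iota> (\<mu> x))" by (simp add: \<iota>.scale)
    moreover have "sE (r - c) (\<iota> (\<mu> x)) = 0" using \<iota>_socle c(2) by (simp add: socle_def)
    ultimately show ?thesis by (simp add: E.scale_left_diff_distrib)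
  qed
  obtain e where e: "\<And>x. x \<in> ideal_pow m n \<Longrightarrow> sE x e = \<iota> (\<mu> x)"
    using extend_from_ideal[OF subspace_ideal_pow, of m n "\<lambda>x. \<iota> (\<mu> x)"] \<mu>_scale Suc.prems(1)
    by (metis \<iota>.add)
  have "\<exists>e'. \<forall>r. \<mu> r - \<sigma> (sE r e) = \<sigma> (sE r e')"
  proof (rule Suc.IH)
    fix x y c
    show "\<mu> (x + y) - \<sigma> (sE (x + y) e) = \<mu> x - \<sigma> (sE x e) + (\<mu> y - \<sigma> (sE y e))"
      by (simp add: Suc.prems(1) E.scale_left_distrib \<sigma>_add)
    show "\<mu> (c * x) - \<sigma> (sE (c * x) e) = c * (\<mu> x - \<sigma> (sE x e))" if "c \<in> k"
      using that Suc.prems(2) by (simp add: \<sigma>_scale right_diff_distrib flip: E.scale_scale)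
    show "\<mu> x - \<sigma> (sE x e) \<in> k"
      using coeff_add[OF Suc.prems(3) coeff_uminus[OF \<sigma>_mem]] by simp
    show "\<mu> x - \<sigma> (sE x e) = 0" if "x \<in> ideal_pow m n"
      using that by (simp add: e \<sigma>_\<iota> Suc.prems(3))
  qed
  then obtain e' where "\<And>r. \<mu> r - \<sigma> (sE r e) = \<sigma> (sE r e')" by blast
  then have "\<mu> r = \<sigma> (sE r (e + e'))" for r
    by (metis E.scale_right_distrib \<sigma>_add add.commute diff_add_cancel)
  then show ?case by blast
qed

end

section \<open>Sigma-continuous functionals\<close>

context complete_local_ring
begin

lemma residue_smult_eq:
  assumes "c \<in> k" "r - c \<in> m"
  shows "residue_smult k m r x = c * x"
proof -
  have "(THE c. c \<in> k \<and> r - c \<in> m) = c"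
    using assms coeff_unique by (intro the_equality) auto
  then show ?thesis by (simp add: residue_smult_def)
qed

lemma residue_smult_coeff: "c \<in> k \<Longrightarrow> residue_smult k m c x = c * x"
  by (rule residue_smult_eq) (simp_all add: ring.subspace_0[OF ideal_m])

lemma residue_smult_m: "a \<in> m \<Longrightarrow> residue_smult k m a x = 0"
  using residue_smult_eq[of 0 a] coeff_0 by simp

sublocale res: module "residue_smult k m"
proof
  fix a b x y :: 'r
  obtain c where c: "c \<in> k" "a - c \<in> m" by (rule coeffE)
  obtain d where d: "d \<in> k" "b - d \<in> m" by (rule coeffE)
  note res = residue_smult_eq[OF c] residue_smult_eq[OF d]
  show "residue_smult k m a (x + y) = residue_smult k m a x + residue_smult k m a y"
    by (simp add: res distrib_left)
  have "(a + b) - (c + d) \<in> m"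
    using ring.subspace_add[OF ideal_m c(2) d(2)] by (simp add: algebra_simps)
  then show "residue_smult k m (a + b) x = residue_smult k m a x + residue_smult k m b x"
    using residue_smult_eq[OF coeff_add[OF c(1) d(1)]] by (simp add: res distrib_right)
  have "a * b - c * d = a * (b - d) + d * (a - c)" by (simp add: algebra_simps)
  then have "a * b - c * d \<in> m"
    using ring.subspace_add[OF ideal_m] ring.subspace_scale[OF ideal_m] c(2) d(2) by metis
  then show "residue_smult k m a (residue_smult k m b x) = residue_smult k m (a * b) x"
    using residue_smult_eq[OF coeff_mult[OF c(1) d(1)]] by (simp add: res mult.assoc)
  show "residue_smult k m 1 x = x" using residue_smult_coeff[OF coeff_1] by simp
qed

text \<open>Over the field \<open>k\<close> a single nonzero element of \<open>S\<close> already
  spans, so this half of Sigma-continuity is automatic for functionals.\<close>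

lemma residue_span_fin_gen:
  assumes "S \<subseteq> k"
  shows "fin_gen (residue_smult k m) (res.span S)"
proof (cases "S \<subseteq> {0}")
  case True
  then have "res.span S \<subseteq> res.span {}"
    by (intro res.span_minimal res.subspace_span) simp
  then have "res.span S = res.span {}" using res.span_mono[of "{}" S] by auto
  then show ?thesis unfolding fin_gen_def by blast
next
  case False
  then obtain c where c: "c \<in> S" "c \<noteq> 0" by auto
  then obtain c' where c': "c' \<in> k" "c * c' = 1" using assms coeff_inverse by blast
  have "x \<in> res.span {c}" if "x \<in> S" for x
  proof -
    have "residue_smult k m (x * c') c = x * c' * c"
      using that assms c'(1) by (intro residue_smult_coeff coeff_mult) auto
    also have "\<dots> = x * (c * c')" by (simp add: ac_simps)
    finally have "x = residue_smult k m (x * c') c" using c'(2) by simp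
    then show ?thesis using res.span_scale[OF res.span_base[of c "{c}"], of "x * c'"] by simp
  qed
  then have "res.span S \<subseteq> res.span {c}" by (intro res.span_minimal res.subspace_span) auto
  moreover have "res.span {c} \<subseteq> res.span S" using c(1) by (intro res.span_mono) simp
  ultimately show ?thesis unfolding fin_gen_def by blast
qed

text \<open>Since \<open>m\<close> annihilates the target, its adic topologies are discrete.\<close>

lemma residue_adic_discrete: "openin (adic_topology m (residue_smult k m) N) U \<longleftrightarrow> U \<subseteq> N"
proof -
  have "ideal_pow m 1 \<subseteq> m"
    unfolding One_nat_def ideal_pow.simps(2) ideal_smult_def
    using ring.subspace_scale[OF ideal_m]
    by (intro ring.span_minimal ideal_m) (force simp: mult.commute)
  then have "{residue_smult k m a x | a x. a \<in> ideal_pow m 1 \<and> x \<in> N} \<subseteq> {0}"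
    using residue_smult_m by auto
  then have "ideal_smult (residue_smult k m) (ideal_pow m 1) N \<subseteq> {0}"
    unfolding ideal_smult_def by (rule res.span_minimal) simp
  then show ?thesis unfolding openin_adic_topology[OF res.module_axioms] by fastforce
qed

text \<open>The target is discrete, so continuity on \<open>L\<close> means that the kernel contains
  some \<open>m^n L\<close>.\<close>

lemma Sigma_dual_iff:
  assumes "module sM"
  shows "f \<in> Sigma_dual k m sM \<longleftrightarrow> range f \<subseteq> k \<and> k_linear k sM (*) f \<and>
    (\<forall>L. fin_gen sM L \<longrightarrow> (\<exists>n. \<forall>y\<in>ideal_smult sM (ideal_pow m n) L. f y = 0))"
proof -
  interpret M: module sM by fact
  have sub: "M.subspace L" if "fin_gen sM L" for L using that by (auto simp: fin_gen_def)
  have "continuous_map (adic_topology m sM L) (adic_topology m (residue_smult k m) (res.span (f ` L))) f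
      \<longleftrightarrow> (\<exists>n. \<forall>y\<in>ideal_smult sM (ideal_pow m n) L. f y = 0)" (is "?cont \<longleftrightarrow> ?vanish")
    if L: "M.subspace L" and f: "k_linear k sM (*) f" for L
  proof
    have add: "f (x + y) = f x + f y" for x y using f by (simp add: k_linear_def)
    have f0: "f 0 = 0" using add[of 0 0] by simp
    {
      assume ?cont
      \<comment> \<open>The preimage of this open singleton is the kernel of \<open>f\<close> on
        \<open>L\<close>.\<close>
      moreover have "openin (adic_topology m (residue_smult k m) (res.span (f ` L))) {0}"
        by (simp add: residue_adic_discrete res.span_zero)
      ultimately have "openin (adic_topology m sM L) {x \<in> L. f x \<in> {0}}"
        unfolding continuous_map_def M.topspace_adic_topology[OF L] by blast
      then show ?vanish
        using f0 M.subspace_0[OF L] unfolding openin_adic_topology[OF M.module_axioms] by fastforce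
    }
    {
      assume ?vanish
      then obtain n where n: "\<And>y. y \<in> ideal_smult sM (ideal_pow m n) L \<Longrightarrow> f y = 0" by blast
      have "x + y \<in> {x \<in> L. f x \<in> U}"
        if "x \<in> {x \<in> L. f x \<in> U}" "y \<in> ideal_smult sM (ideal_pow m n) L" for x y U
        using that n[OF that(2)] M.ideal_smult_subset[OF L] M.subspace_add[OF L] by (auto simp: add)
      then show ?cont
        unfolding continuous_map_def M.topspace_adic_topology[OF L]
          res.topspace_adic_topology[OF res.subspace_span] openin_adic_topology[OF M.module_axioms]
        using res.span_superset[of "f ` L"] by blast
    }
  qed
  moreover have "k_linear k sM (residue_smult k m) f \<longleftrightarrow> k_linear k sM (*) f"
    by (simp add: k_linear_def residue_smult_coeff)
  moreover have "fin_gen (residue_smult k m) (res.span (f ` L))" if "range f \<subseteq> k" for L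
    using that by (intro residue_span_fin_gen) blast
  ultimately show ?thesis
    unfolding Sigma_dual_def Sigma_continuous_def using sub by blast
qed

end

text \<open>\<open>f\<close> vanishes on some \<open>m^n\<close> multiple of the span of the image
  of \<open>L\<close>. Its preimage under \<open>\<delta>\<close> is an open neighbourhood of
  \<open>0\<close>, hence contains some \<open>m^p L\<close>.\<close>

lemma (in complete_local_ring) Sigma_dual_comp:
  assumes M: "module sM" and N: "module sN"
    and f: "f \<in> Sigma_dual k m sN" and \<delta>: "Sigma_continuous k m sM sN \<delta>"
  shows "f \<circ> \<delta> \<in> Sigma_dual k m sM"
proof -
  interpret M: module sM by fact
  interpret N: module sN by fact
  have "\<exists>n. \<forall>y\<in>ideal_smult sM (ideal_pow m n) L. (f \<circ> \<delta>) y = 0" if L: "fin_gen sM L" for L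
  proof -
    have L': "M.subspace L" using L by (auto simp: fin_gen_def)
    let ?N = "N.span (\<delta> ` L)"
    have "fin_gen sN ?N"
      and cont: "continuous_map (adic_topology m sM L) (adic_topology m sN ?N) \<delta>"
      using \<delta> L by (auto simp: Sigma_continuous_def)
    then obtain n where n: "\<And>z. z \<in> ideal_smult sN (ideal_pow m n) ?N \<Longrightarrow> f z = 0"
      using f unfolding Sigma_dual_iff[OF N] by blast
    let ?U = "ideal_smult sN (ideal_pow m n) ?N"
    have "openin (adic_topology m sM L) {x \<in> L. \<delta> x \<in> ?U}"
      using cont N.openin_adic_ideal_smult[OF N.subspace_span]
      unfolding continuous_map_def M.topspace_adic_topology[OF L'] by blast
    moreover have "\<delta> 0 + \<delta> 0 = \<delta> 0"
      using \<delta> unfolding Sigma_continuous_def k_linear_def by (metis add_0)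
    then have "0 \<in> {x \<in> L. \<delta> x \<in> ?U}"
      using M.subspace_0[OF L'] N.subspace_0[OF N.subspace_ideal_smult] by simp
    ultimately obtain p where
      "\<And>y. y \<in> ideal_smult sM (ideal_pow m p) L \<Longrightarrow> 0 + y \<in> {x \<in> L. \<delta> x \<in> ?U}"
      unfolding openin_adic_topology[OF M] by blast
    then have "\<forall>y\<in>ideal_smult sM (ideal_pow m p) L. (f \<circ> \<delta>) y = 0"
      using n by simp
    then show ?thesis ..
  qed
  then show ?thesis
    using f \<delta> unfolding Sigma_dual_iff[OF N] Sigma_dual_iff[OF M]
    by (auto simp: k_linear_def Sigma_continuous_def)
qed

section \<open>Matlis duals\<close>

context residue_injective_hull
begin

text \<open>Each element of \<open>E\<close> is annihilated by a power of \<open>m\<close>; for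
  finitely generated \<open>L\<close> one power annihilates all of \<open>\<phi> L\<close>.\<close>

lemma Phi_mem_Sigma_dual:
  assumes M: "module sM" and "\<phi> \<in> matlis_dual sE sM"
  shows "Phi \<sigma> \<phi> \<in> Sigma_dual k m sM"
proof -
  interpret M: module sM by fact
  interpret \<phi>: module_hom sM sE \<phi> using assms(2) by (simp add: matlis_dual_def)
  have "\<exists>n. \<forall>y\<in>ideal_smult sM (ideal_pow m n) L. Phi \<sigma> \<phi> y = 0" if L: "fin_gen sM L" for L
  proof -
    obtain X where X: "finite X" "L = M.span X" using L by (auto simp: fin_gen_def)
    obtain h where h: "\<And>e a. a \<in> ideal_pow m (h e) \<Longrightarrow> sE a e = 0"
      using ideal_pow_annihilates by metis
    obtain n where n: "\<And>x. x \<in> X \<Longrightarrow> h (\<phi> x) \<le> n"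
      using finite_imageI[OF X(1), of "h \<circ> \<phi>"] by (auto simp: finite_nat_set_iff_bounded_le)
    have "\<phi> (sM a x) = 0" if "x \<in> L" "a \<in> ideal_pow m n" for a x
      using that(1) unfolding X(2)
    proof (induction rule: M.span_induct_alt)
      case base
      then show ?case by simp
    next
      case (step c x y)
      have "sE a (\<phi> x) = 0"
        using h ideal_pow_antimono[OF n[OF step(1)]] that(2) by blast
      then have "sE c (sE a (\<phi> x)) = 0" by simp
      then have "\<phi> (sM a (sM c x)) = 0" by (simp add: \<phi>.scale mult.commute)
      with step(2) show ?case by (simp add: M.scale_right_distrib \<phi>.add del: M.scale_scale)
    qed
    then have "{sM a x | a x. a \<in> ideal_pow m n \<and> x \<in> L} \<subseteq> {y. \<phi> y = 0}" by blast
    then have "ideal_smult sM (ideal_pow m n) L \<subseteq> {y. \<phi> y = 0}"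
      unfolding ideal_smult_def by (rule M.span_minimal) (rule \<phi>.subspace_kernel)
    then show ?thesis by (intro exI[of _ n]) (auto simp: Phi_def \<sigma>_0)
  qed
  then show ?thesis
    unfolding Sigma_dual_iff[OF M]
    by (auto simp: Phi_def k_linear_def \<phi>.add \<phi>.scale \<sigma>_add \<sigma>_scale \<sigma>_mem)
qed

text \<open>Comparing the functionals at all multiples of \<open>x\<close> is the test for equality
  in \<open>E\<close>.\<close>

lemma Phi_eq_iff:
  assumes "\<phi> \<in> matlis_dual sE sM" "\<psi> \<in> matlis_dual sE sM"
  shows "Phi \<sigma> \<phi> = Phi \<sigma> \<psi> \<longleftrightarrow> \<phi> = \<psi>"
proof
  interpret \<phi>: module_hom sM sE \<phi> using assms(1) by (simp add: matlis_dual_def)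
  interpret \<psi>: module_hom sM sE \<psi> using assms(2) by (simp add: matlis_dual_def)
  assume eq: "Phi \<sigma> \<phi> = Phi \<sigma> \<psi>"
  show "\<phi> = \<psi>"
  proof
    fix x
    have "\<sigma> (\<phi> (sM r x)) = \<sigma> (\<psi> (sM r x))" for r
      using fun_cong[OF eq] by (simp add: Phi_def)
    then show "\<phi> x = \<psi> x" by (intro eq_if_\<sigma>_eq) (simp add: \<phi>.scale \<psi>.scale)
  qed
qed simp

text \<open>For fixed \<open>x\<close> the functional sending \<open>r\<close> to
  \<open>f (r x)\<close> vanishes on a power of \<open>m\<close>, so an element
  \<open>\<phi> x\<close> of \<open>E\<close> represents it. Uniqueness of that element makes
  \<open>\<phi>\<close> linear.\<close>

lemma Sigma_dual_is_Phi:
  assumes M: "module sM" and f: "f \<in> Sigma_dual k m sM"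
  shows "f \<in> Phi \<sigma> ` matlis_dual sE sM"
proof -
  interpret M: module sM by fact
  have range: "range f \<subseteq> k" and lin: "k_linear k sM (*) f"
    and cont: "\<And>L. fin_gen sM L \<Longrightarrow> \<exists>n. \<forall>y\<in>ideal_smult sM (ideal_pow m n) L. f y = 0"
    using f unfolding Sigma_dual_iff[OF M] by blast+
  have "\<exists>e. \<forall>r. f (sM r x) = \<sigma> (sE r e)" for x
  proof -
    have "fin_gen sM (M.span {x})" unfolding fin_gen_def by blast
    then obtain n where n: "\<And>y. y \<in> ideal_smult sM (ideal_pow m n) (M.span {x}) \<Longrightarrow> f y = 0"
      using cont by blast
    show ?thesis
    proof (rule functional_representable)
      show "f (sM (a + b) x) = f (sM a x) + f (sM b x)" for a b
        using lin by (simp add: k_linear_def M.scale_left_distrib)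
      show "f (sM (c * a) x) = c * f (sM a x)" if "c \<in> k" for c a
        using lin that by (simp add: k_linear_def flip: M.scale_scale)
      show "f (sM a x) \<in> k" for a using range by blast
      show "f (sM a x) = 0" if "a \<in> ideal_pow m n" for a
        using that M.span_base[of x "{x}"]
        by (intro n) (auto simp: ideal_smult_def intro!: M.span_base)
    qed
  qed
  then obtain \<phi> where \<phi>: "\<And>x r. f (sM r x) = \<sigma> (sE r (\<phi> x))" by metis
  have "module_hom sM sE \<phi>"
  proof
    show "\<phi> (x + y) = \<phi> x + \<phi> y" for x y
      using lin by (intro eq_if_\<sigma>_eq)
        (simp add: k_linear_def M.scale_right_distrib E.scale_right_distrib \<sigma>_add flip: \<phi>)
    show "\<phi> (sM a x) = sE a (\<phi> x)" for a x
      by (intro eq_if_\<sigma>_eq) (simp flip: \<phi>)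
  qed
  \<comment> \<open>Taking \<open>r = 1\<close> recovers \<open>f\<close>.\<close>
  moreover have "f = Phi \<sigma> \<phi>"
    using \<phi>[of 1] by (auto simp: Phi_def)
  ultimately show ?thesis by (simp add: matlis_dual_def)
qed

lemma bij_betw_Phi: "module sM \<Longrightarrow> bij_betw (Phi \<sigma>) (matlis_dual sE sM) (Sigma_dual k m sM)"
  unfolding bij_betw_def
  by (auto intro: inj_onI Phi_mem_Sigma_dual Sigma_dual_is_Phi simp: Phi_eq_iff)

text \<open>The functional on the right lies in the image of \<open>Phi \<sigma>\<close>, so the
  \<open>inv_into\<close> in the definition is a genuine preimage.\<close>

lemma
  assumes "module sM" "module sN" "Sigma_continuous k m sM sN \<delta>" "\<phi> \<in> matlis_dual sE sN"
  shows matlis_dual_map_mem: "matlis_dual_map sE \<sigma> sM \<delta> \<phi> \<in> matlis_dual sE sM"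
    and Phi_matlis_dual_map: "Phi \<sigma> (matlis_dual_map sE \<sigma> sM \<delta> \<phi>) = Phi \<sigma> \<phi> \<circ> \<delta>"
proof -
  have "Phi \<sigma> \<phi> \<circ> \<delta> \<in> Phi \<sigma> ` matlis_dual sE sM"
    using assms by (intro Sigma_dual_is_Phi Sigma_dual_comp Phi_mem_Sigma_dual)
  then show "matlis_dual_map sE \<sigma> sM \<delta> \<phi> \<in> matlis_dual sE sM"
    and "Phi \<sigma> (matlis_dual_map sE \<sigma> sM \<delta> \<phi>) = Phi \<sigma> \<phi> \<circ> \<delta>"
    unfolding matlis_dual_map_def by (rule inv_into_into, rule f_inv_into_f)
qed

text \<open>Injectivity of \<open>Phi \<sigma>\<close> identifies a dual map from its functional;
  the algebraic laws below reduce to this.\<close>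

lemma matlis_dual_map_eqI:
  assumes "\<psi> \<in> matlis_dual sE sM" "Phi \<sigma> \<psi> = Phi \<sigma> \<phi> \<circ> \<delta>"
  shows "matlis_dual_map sE \<sigma> sM \<delta> \<phi> = \<psi>"
  unfolding matlis_dual_map_def assms(2)[symmetric]
  using assms(1) by (intro inv_into_f_f inj_onI) (simp_all add: Phi_eq_iff)

lemma Phi_add: "Phi \<sigma> (\<phi> + \<psi>) = Phi \<sigma> \<phi> + Phi \<sigma> \<psi>"
  by (simp add: Phi_def fun_eq_iff \<sigma>_add)

lemma matlis_dualI:
  assumes "module sM" "\<And>x y. \<phi> (x + y) = \<phi> x + \<phi> y" "\<And>r x. \<phi> (sM r x) = sE r (\<phi> x)"
  shows "\<phi> \<in> matlis_dual sE sM"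
proof -
  interpret M: module sM by fact
  show ?thesis
    unfolding matlis_dual_def using assms(2,3)
    by (auto intro!: module_hom.intro module_hom_axioms.intro M.module_axioms E.module_axioms)
qed

lemma matlis_dual_0: "module sM \<Longrightarrow> 0 \<in> matlis_dual sE sM"
  by (rule matlis_dualI) simp_all

lemma matlis_dual_add:
  assumes "module sM" "\<phi> \<in> matlis_dual sE sM" "\<psi> \<in> matlis_dual sE sM"
  shows "\<phi> + \<psi> \<in> matlis_dual sE sM"
proof -
  interpret \<phi>: module_hom sM sE \<phi> using assms(2) by (simp add: matlis_dual_def)
  interpret \<psi>: module_hom sM sE \<psi> using assms(3) by (simp add: matlis_dual_def)
  show ?thesis
    by (rule matlis_dualI[OF assms(1)])
      (simp_all add: \<phi>.add \<psi>.add \<phi>.scale \<psi>.scale E.scale_right_distrib)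
qed

lemma matlis_dual_smult:
  assumes "module sM" "\<phi> \<in> matlis_dual sE sM"
  shows "(\<lambda>x. sE r (\<phi> x)) \<in> matlis_dual sE sM"
proof -
  interpret \<phi>: module_hom sM sE \<phi> using assms(2) by (simp add: matlis_dual_def)
  show ?thesis
    by (rule matlis_dualI[OF assms(1)])
      (simp_all add: \<phi>.add \<phi>.scale E.scale_right_distrib mult.commute)
qed

lemma matlis_dual_uminus:
  assumes "module sM" "\<phi> \<in> matlis_dual sE sM"
  shows "- \<phi> \<in> matlis_dual sE sM"
  using matlis_dual_smult[OF assms, of "- 1"] by (simp add: fun_Compl_def)

section \<open>Algebra of dual maps on a single module\<close>

context
  fixes sM :: "'r \<Rightarrow> 'm::ab_group_add \<Rightarrow> 'm"
  assumes M: "module sM"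
begin

abbreviation dual_map :: "('m \<Rightarrow> 'm) \<Rightarrow> ('m \<Rightarrow> 'e) \<Rightarrow> 'm \<Rightarrow> 'e" where
  "dual_map \<equiv> matlis_dual_map sE \<sigma> sM"

abbreviation DM :: "('m \<Rightarrow> 'e) set" where
  "DM \<equiv> matlis_dual sE sM"

lemmas dual_map_mem = matlis_dual_map_mem[OF M M]
lemmas Phi_dual_map = Phi_matlis_dual_map[OF M M]

lemma dual_map_add:
  assumes "Sigma_continuous k m sM sM \<delta>" "\<phi> \<in> DM" "\<psi> \<in> DM"
  shows "dual_map \<delta> (\<phi> + \<psi>) = dual_map \<delta> \<phi> + dual_map \<delta> \<psi>"
  using assms by (intro matlis_dual_map_eqI matlis_dual_add[OF M] dual_map_mem)
    (simp_all add: Phi_add Phi_dual_map fun_eq_iff)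

text \<open>The pointwise equation for \<open>\<gamma>\<close> lets the action of a sum be inserted
  directly, for left and right modules alike.\<close>

lemma dual_map_plus:
  assumes "Sigma_continuous k m sM sM \<delta>" "Sigma_continuous k m sM sM \<epsilon>" "\<phi> \<in> DM"
    and "\<And>x. \<gamma> x = \<delta> x + \<epsilon> x"
  shows "dual_map \<gamma> \<phi> = dual_map \<delta> \<phi> + dual_map \<epsilon> \<phi>"
proof (rule matlis_dual_map_eqI)
  interpret \<phi>: module_hom sM sE \<phi> using assms(3) by (simp add: matlis_dual_def)
  have "Phi \<sigma> \<phi> (x + y) = Phi \<sigma> \<phi> x + Phi \<sigma> \<phi> y" for x y
    by (simp add: Phi_def \<phi>.add \<sigma>_add)
  then show "Phi \<sigma> (dual_map \<delta> \<phi> + dual_map \<epsilon> \<phi>) = Phi \<sigma> \<phi> \<circ> \<gamma>"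
    using assms by (simp add: Phi_add Phi_dual_map fun_eq_iff)
qed (use assms in \<open>intro matlis_dual_add[OF M] dual_map_mem\<close>)

text \<open>Contravariance is what exchanges left and right modules.\<close>

lemma dual_map_comp:
  assumes "Sigma_continuous k m sM sM \<delta>" "Sigma_continuous k m sM sM \<epsilon>" "\<phi> \<in> DM"
    and "\<And>x. \<gamma> x = \<delta> (\<epsilon> x)"
  shows "dual_map \<gamma> \<phi> = dual_map \<epsilon> (dual_map \<delta> \<phi>)"
  using assms by (intro matlis_dual_map_eqI dual_map_mem)
    (simp_all add: Phi_dual_map dual_map_mem fun_eq_iff)

lemma dual_map_id:
  assumes "\<phi> \<in> DM" "\<And>x. \<gamma> x = x"
  shows "dual_map \<gamma> \<phi> = \<phi>"
  using assms by (intro matlis_dual_map_eqI) (simp_all add: fun_eq_iff)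

text \<open>For multiplication by a ring element the dual is precomposition, as for homomorphisms.
  The dual action thus extends the usual \<open>R\<close>-module structure.\<close>

lemma dual_map_smult:
  assumes "\<phi> \<in> DM"
  shows "dual_map (sM r) \<phi> = (\<lambda>x. sE r (\<phi> x))"
proof (rule matlis_dual_map_eqI)
  interpret \<phi>: module_hom sM sE \<phi> using assms by (simp add: matlis_dual_def)
  show "Phi \<sigma> (\<lambda>x. sE r (\<phi> x)) = Phi \<sigma> \<phi> \<circ> sM r"
    by (simp add: Phi_def fun_eq_iff \<phi>.scale)
qed (rule matlis_dual_smult[OF M assms])

end

end

text \<open>Sigma-continuity and bijectivity of \<open>Phi \<sigma>\<close> make the dual action
  well defined; compatibility with \<open>R\<close> ties it to the usual module structure on
  homomorphisms into \<open>E\<close>.\<close>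

theorem corollary4p10:
  fixes m k :: "'r::comm_ring_1 set"
    and sE :: "'r \<Rightarrow> 'e::ab_group_add \<Rightarrow> 'e" and \<iota> :: "'r \<Rightarrow> 'e" and \<sigma> :: "'e \<Rightarrow> 'r"
  assumes R: "complete_noetherian_local_ring m"
    and k: "coefficient_field k m"
    and E: "injective_hull_residue_field m sE \<iota>"
    and \<sigma>: "socle_projection k m sE \<iota> \<sigma>"
  shows
    "(\<forall>act :: ('r \<Rightarrow> 'r) \<Rightarrow> 'm::ab_group_add \<Rightarrow> 'm.
        left_D_module (diff_ops k) UNIV act \<longrightarrow>
        (let sM = (\<lambda>r. act ((*) r)); DM = matlis_dual sE sM;
             dual_act = (\<lambda>\<phi> \<delta>. matlis_dual_map sE \<sigma> sM (act \<delta>) \<phi>)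
         in (\<forall>\<delta>\<in>diff_ops k. Sigma_continuous k m sM sM (act \<delta>)) \<and>
            bij_betw (Phi \<sigma>) DM (Sigma_dual k m sM) \<and>
            right_D_module (diff_ops k) DM dual_act \<and>
            (\<forall>\<phi>\<in>DM. \<forall>r. dual_act \<phi> ((*) r) = (\<lambda>x. sE r (\<phi> x)))))
     \<and>
     (\<forall>act :: 'm \<Rightarrow> ('r \<Rightarrow> 'r) \<Rightarrow> 'm.
        right_D_module (diff_ops k) UNIV act \<longrightarrow>
        (let sM = (\<lambda>r x. act x ((*) r)); DM = matlis_dual sE sM;
             dual_act = (\<lambda>\<delta> \<phi>. matlis_dual_map sE \<sigma> sM (\<lambda>x. act x \<delta>) \<phi>)
         in (\<forall>\<delta>\<in>diff_ops k. Sigma_continuous k m sM sM (\<lambda>x. act x \<delta>)) \<and>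
            bij_betw (Phi \<sigma>) DM (Sigma_dual k m sM) \<and>
            left_D_module (diff_ops k) DM dual_act \<and>
            (\<forall>\<phi>\<in>DM. \<forall>r. dual_act ((*) r) \<phi> = (\<lambda>x. sE r (\<phi> x)))))"
proof -
  interpret residue_injective_hull m k sE \<iota> \<sigma>
    by unfold_locales (fact R k E \<sigma>)+
  show ?thesis
    unfolding Let_def
  proof (intro conjI allI impI ballI)
    fix act :: "('r \<Rightarrow> 'r) \<Rightarrow> 'm \<Rightarrow> 'm"
    assume "left_D_module (diff_ops k) UNIV act"
    then interpret left_D_module "diff_ops k" UNIV act .
    interpret L: left_diff_ops_module m k act by unfold_locales
    note M = L.M.module_axioms and cont = L.Sigma_continuous_act
    show "Sigma_continuous k m L.smult L.smult (act \<delta>)" if "\<delta> \<in> diff_ops k" for \<delta>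
      using that by (rule cont)
    show "bij_betw (Phi \<sigma>) (matlis_dual sE L.smult) (Sigma_dual k m L.smult)"
      using M by (rule bij_betw_Phi)
    show "right_D_module (diff_ops k) (matlis_dual sE L.smult)
        (\<lambda>\<phi> \<delta>. matlis_dual_map sE \<sigma> L.smult (act \<delta>) \<phi>)"
      \<comment> \<open>Membership and additivity come from the dual maps; associativity of the
        right action is \<open>dual_map_comp\<close> with its reversed order.\<close>
      by (rule right_D_module.intro)
        (auto intro: matlis_dual_0[OF M] matlis_dual_add[OF M] matlis_dual_uminus[OF M]
          dual_map_mem[OF M] dual_map_add[OF M] dual_map_plus[OF M] dual_map_comp[OF M]
          dual_map_id[OF M] cont simp: add_act comp_act id_act)
    show "matlis_dual_map sE \<sigma> L.smult (L.smult r) \<phi> = (\<lambda>x. sE r (\<phi> x))"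
      if "\<phi> \<in> matlis_dual sE L.smult" for \<phi> r
      using M that by (rule dual_map_smult)
  next
    fix act :: "'m \<Rightarrow> ('r \<Rightarrow> 'r) \<Rightarrow> 'm"
    assume "right_D_module (diff_ops k) UNIV act"
    then interpret right_D_module "diff_ops k" UNIV act .
    interpret L: right_diff_ops_module m k act by unfold_locales
    note M = L.M.module_axioms and cont = L.Sigma_continuous_act
    show "Sigma_continuous k m L.smult L.smult (\<lambda>x. act x \<delta>)" if "\<delta> \<in> diff_ops k" for \<delta>
      using that by (rule cont)
    show "bij_betw (Phi \<sigma>) (matlis_dual sE L.smult) (Sigma_dual k m L.smult)"
      using M by (rule bij_betw_Phi)
    show "left_D_module (diff_ops k) (matlis_dual sE L.smult)
        (\<lambda>\<delta> \<phi>. matlis_dual_map sE \<sigma> L.smult (\<lambda>x. act x \<delta>) \<phi>)"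
      by (rule left_D_module.intro)
        (auto intro: matlis_dual_0[OF M] matlis_dual_add[OF M] matlis_dual_uminus[OF M]
          dual_map_mem[OF M] dual_map_add[OF M] dual_map_plus[OF M] dual_map_comp[OF M]
          dual_map_id[OF M] cont simp: act_add act_comp act_id)
    show "matlis_dual_map sE \<sigma> L.smult (L.smult r) \<phi> = (\<lambda>x. sE r (\<phi> x))"
      if "\<phi> \<in> matlis_dual sE L.smult" for \<phi> r
      using M that by (rule dual_map_smult)
  qed
qed

end
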